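(* For each $n$ let $(X_1,Y_1),\dots,(X_n,Y_n)$ be i.i.d. with $X_i\in\mathbb{R}^p$ and $Y_i=\beta^TX_i+\epsilon_i$, where $\beta\in\mathbb{R}^p$, $E(\epsilon_i\mid X_i)=0$, $E(\epsilon_i^2\mid X_i)=\sigma^2$, $E(X_i)=\mathbf{0}$ and $\mathrm{Cov}(X_i)=\mathbf{I}$. Let $\tau^2=\|\beta\|^2$ and $\mathbf{A}=E(\mathbf{W}_i\mathbf{W}_i^T)$, where $\mathbf{W}_i=Y_iX_i\in\mathbb{R}^p$. Assume that $\tau^2+\sigma^2=O(1)$ and $\|\mathbf{A}\|_F^2/n^2\to0$ as $n,p\to\infty$. Then $\hat\tau^2$ is consistent, i.e. $\hat\tau^2-\tau^2\to0$ in probability. Moreover, if (with $\tau^2+\sigma^2=O(1)$) the columns of the design matrix $\mathbf{X}$ are independent and both $p/n$ and $E(X_{ij}^4)$ are bounded, then $\|\mathbf{A}\|_F^2/n^2\to0$ holds and $\hat\tau^2$ is $\sqrt n$-consistent, i.e. $\sqrt n(\hat\tau^2-\tau^2)=O_p(1)$.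
   Context: Asymptotics: $n$ and $p=p_n$ go to infinity together; $\beta$, $\sigma^2$ and the distribution of $X_i$ may depend on $n$; bounds are uniform in $n$ and $j$. The design matrix $\mathbf{X}$ is $n\times p$ with rows $X_i^T$; independence of its columns means that $X_{i1},\dots,X_{ip}$ are independent. $\|\cdot\|_F$ is the Frobenius norm. With $W_{ij}=X_{ij}Y_i$, the naive estimator is $\hat\tau^2=\frac{1}{n(n-1)}\sum_{j=1}^p\sum_{i_1\ne i_2}W_{i_1j}W_{i_2j}$. *)

theory Defs
  imports "HOL-Probability.Probability" "HOL-Library.Landau_Symbols"
begin

text \<open>
  Observations are indexed by \<open>i < n\<close> and coordinates by \<open>j < p\<close>; \<open>X i j \<omega>\<close> is the
  \<open>j\<close>-th coordinate of the \<open>i\<close>-th covariate vector at \<open>\<omega>\<close>. Values outside these index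
  ranges are irrelevant.
\<close>

abbreviation vec_space :: "nat \<Rightarrow> (nat \<Rightarrow> real) measure" where
  "vec_space p \<equiv> Pi\<^sub>M {..<p} (\<lambda>_. borel)"

definition row :: "nat \<Rightarrow> (nat \<Rightarrow> nat \<Rightarrow> 'a \<Rightarrow> real) \<Rightarrow> nat \<Rightarrow> 'a \<Rightarrow> (nat \<Rightarrow> real)" where
  "row p X i \<omega> = (\<lambda>j\<in>{..<p}. X i j \<omega>)"

definition covariance :: "'a measure \<Rightarrow> ('a \<Rightarrow> real) \<Rightarrow> ('a \<Rightarrow> real) \<Rightarrow> real" where
  "covariance M U V =
     (LINT \<omega>|M. (U \<omega> - (LINT \<omega>'|M. U \<omega>')) * (V \<omega> - (LINT \<omega>'|M. V \<omega>')))"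

locale linear_model_sample = prob_space M
  for M :: "'a measure" +
  fixes n p :: nat
    and \<beta> :: "nat \<Rightarrow> real"
    and \<sigma> :: real
    and X :: "nat \<Rightarrow> nat \<Rightarrow> 'a \<Rightarrow> real"
    and \<epsilon> :: "nat \<Rightarrow> 'a \<Rightarrow> real"
    and Y :: "nat \<Rightarrow> 'a \<Rightarrow> real"
  assumes independent:
      "indep_vars (\<lambda>_. vec_space p \<Otimes>\<^sub>M borel) (\<lambda>i \<omega>. (row p X i \<omega>, Y i \<omega>)) {..<n}"
    and identically_distributed:
      "\<And>i i'. i < n \<Longrightarrow> i' < n \<Longrightarrow>
         distr M (vec_space p \<Otimes>\<^sub>M borel) (\<lambda>\<omega>. (row p X i \<omega>, Y i \<omega>)) =
         distr M (vec_space p \<Otimes>\<^sub>M borel) (\<lambda>\<omega>. (row p X i' \<omega>, Y i' \<omega>))"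
    and linear_model:
      "\<And>i \<omega>. i < n \<Longrightarrow> \<omega> \<in> space M \<Longrightarrow> Y i \<omega> = (\<Sum>j<p. \<beta> j * X i j \<omega>) + \<epsilon> i \<omega>"
    \<comment> \<open>Finiteness of the second moments is explicit because \<open>real_cond_exp\<close> and the Bochner
       integral are total: they also return a real number where the moment is infinite.\<close>
    and noise_square_integrable:
      "\<And>i. i < n \<Longrightarrow> integrable M (\<lambda>\<omega>. (\<epsilon> i \<omega>)\<^sup>2)"
    and noise_cond_mean:
      "\<And>i. i < n \<Longrightarrow> AE \<omega> in M.
         real_cond_exp M (vimage_algebra (space M) (row p X i) (vec_space p)) (\<epsilon> i) \<omega> = 0"
    and noise_cond_variance:
      "\<And>i. i < n \<Longrightarrow> AE \<omega> in M.
         real_cond_exp M (vimage_algebra (space M) (row p X i) (vec_space p))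
           (\<lambda>\<omega>. (\<epsilon> i \<omega>)\<^sup>2) \<omega> = \<sigma>\<^sup>2"
    and covariate_square_integrable:
      "\<And>i j. i < n \<Longrightarrow> j < p \<Longrightarrow> integrable M (\<lambda>\<omega>. (X i j \<omega>)\<^sup>2)"
    and covariate_mean:
      "\<And>i j. i < n \<Longrightarrow> j < p \<Longrightarrow> expectation (X i j) = 0"
    and covariate_covariance:
      "\<And>i j k. i < n \<Longrightarrow> j < p \<Longrightarrow> k < p \<Longrightarrow>
         covariance M (X i j) (X i k) = (if j = k then 1 else 0)"

definition independent_columns ::
    "'a measure \<Rightarrow> nat \<Rightarrow> nat \<Rightarrow> (nat \<Rightarrow> nat \<Rightarrow> 'a \<Rightarrow> real) \<Rightarrow> bool" where
  "independent_columns M n p X \<longleftrightarrow>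
     (\<forall>i<n. prob_space.indep_vars M (\<lambda>_. borel) (\<lambda>j. X i j) {..<p})"

definition signal_strength :: "nat \<Rightarrow> (nat \<Rightarrow> real) \<Rightarrow> real" where
  "signal_strength p \<beta> = (\<Sum>j<p. (\<beta> j)\<^sup>2)"

definition W :: "(nat \<Rightarrow> nat \<Rightarrow> 'a \<Rightarrow> real) \<Rightarrow> (nat \<Rightarrow> 'a \<Rightarrow> real) \<Rightarrow> nat \<Rightarrow> nat \<Rightarrow> 'a \<Rightarrow> real" where
  "W X Y i j \<omega> = X i j \<omega> * Y i \<omega>"

text \<open>
  The matrix \<open>E(W\<^sub>i W\<^sub>i\<^sup>T)\<close> does not depend on \<open>i\<close> for identically distributed observations;
  it is taken at \<open>i = 0\<close>. The Bochner integral is \<open>0\<close> on non-integrable functions, so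
  existence of the matrix is a separate predicate.
\<close>

definition A_matrix ::
    "'a measure \<Rightarrow> (nat \<Rightarrow> nat \<Rightarrow> 'a \<Rightarrow> real) \<Rightarrow> (nat \<Rightarrow> 'a \<Rightarrow> real) \<Rightarrow> nat \<Rightarrow> nat \<Rightarrow> real" where
  "A_matrix M X Y j k = (LINT \<omega>|M. W X Y 0 j \<omega> * W X Y 0 k \<omega>)"

definition A_matrix_exists ::
    "'a measure \<Rightarrow> nat \<Rightarrow> (nat \<Rightarrow> nat \<Rightarrow> 'a \<Rightarrow> real) \<Rightarrow> (nat \<Rightarrow> 'a \<Rightarrow> real) \<Rightarrow> bool" where
  "A_matrix_exists M p X Y \<longleftrightarrow>
     (\<forall>j<p. \<forall>k<p. integrable M (\<lambda>\<omega>. W X Y 0 j \<omega> * W X Y 0 k \<omega>))"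

definition frobenius_norm :: "nat \<Rightarrow> (nat \<Rightarrow> nat \<Rightarrow> real) \<Rightarrow> real" where
  "frobenius_norm p B = sqrt (\<Sum>j<p. \<Sum>k<p. (B j k)\<^sup>2)"

definition naive_estimator ::
    "nat \<Rightarrow> nat \<Rightarrow> (nat \<Rightarrow> nat \<Rightarrow> 'a \<Rightarrow> real) \<Rightarrow> (nat \<Rightarrow> 'a \<Rightarrow> real) \<Rightarrow> 'a \<Rightarrow> real" where
  "naive_estimator n p X Y \<omega> =
     1 / (real n * (real n - 1)) *
       (\<Sum>j<p. \<Sum>i\<^sub>1<n. \<Sum>i\<^sub>2\<in>{..<n} - {i\<^sub>1}. W X Y i\<^sub>1 j \<omega> * W X Y i\<^sub>2 j \<omega>)"

text \<open>The probability space may change with \<open>n\<close> in the following two notions.\<close>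

definition tends_to_zero_in_probability ::
    "(nat \<Rightarrow> 'a measure) \<Rightarrow> (nat \<Rightarrow> 'a \<Rightarrow> real) \<Rightarrow> bool" where
  "tends_to_zero_in_probability M Z \<longleftrightarrow>
     (\<forall>\<delta>>0. (\<lambda>n. measure (M n) {\<omega> \<in> space (M n). \<bar>Z n \<omega>\<bar> > \<delta>}) \<longlonglongrightarrow> 0)"

definition bounded_in_probability ::
    "(nat \<Rightarrow> 'a measure) \<Rightarrow> (nat \<Rightarrow> 'a \<Rightarrow> real) \<Rightarrow> bool" where
  "bounded_in_probability M Z \<longleftrightarrow>
     (\<forall>\<delta>>0. \<exists>K. \<forall>\<^sub>F n in sequentially.
        measure (M n) {\<omega> \<in> space (M n). \<bar>Z n \<omega>\<bar> > K} \<le> \<delta>)"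

end

theory Submission
  imports Defs
begin

text \<open>
  With \<open>V\<^sub>i = W\<^sub>i - \<beta>\<close> the error of the estimator splits into a degenerate and a linear part
  (the Hoeffding decomposition),
  \<open>2 / (n (n - 1)) * (\<Sum>i. \<Sum>i' < i. V\<^sub>i' \<bullet> V\<^sub>i) + 2 / n * (\<Sum>i. \<beta> \<bullet> V\<^sub>i)\<close>.
  The first sum is a martingale in the number of observations, so its second moment is
  \<open>n (n - 1) / 2\<close> times the squared Frobenius norm of \<open>Cov W = A - \<beta> \<beta>\<^sup>T\<close>, which is at most that of
  \<open>A\<close>; the second has second moment at most \<open>n \<beta>\<^sup>T A \<beta>\<close>. Markov's inequality for the squared
  error gives consistency, because \<open>\<beta>\<^sup>T A \<beta> \<le> \<tau>\<^sup>2 \<parallel>A\<parallel>\<close>. When the columns are independent,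
  \<open>A\<close> is \<open>2 \<beta> \<beta>\<^sup>T\<close> plus a bounded diagonal matrix, so \<open>\<parallel>A\<parallel>\<^sup>2 = O(p) = O(n)\<close> and
  \<open>\<beta>\<^sup>T A \<beta> = O(1)\<close>.
\<close>

section \<open>Square-integrable functions and products of independent ones\<close>

text \<open>Measurability is part of the notion because integrability of the square alone does not
  make \<open>f\<close> measurable.\<close>

definition square_integrable :: "'a measure \<Rightarrow> ('a \<Rightarrow> real) \<Rightarrow> bool" where
  "square_integrable M f \<longleftrightarrow> f \<in> borel_measurable M \<and> integrable M (\<lambda>x. (f x)\<^sup>2)"

lemma square_integrable_measurable: "square_integrable M f \<Longrightarrow> f \<in> borel_measurable M"
  and square_integrable_square: "square_integrable M f \<Longrightarrow> integrable M (\<lambda>x. (f x)\<^sup>2)"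
  by (simp_all add: square_integrable_def)

lemma square_integrable_mult:
  assumes "square_integrable M f" "square_integrable M g"
  shows "integrable M (\<lambda>x. f x * g x)"
proof (rule Bochner_Integration.integrable_bound)
  show "integrable M (\<lambda>x. (f x)\<^sup>2 + (g x)\<^sup>2)"
    using assms by (simp add: square_integrable_def)
  show "(\<lambda>x. f x * g x) \<in> borel_measurable M"
    using assms by (auto simp: square_integrable_def)
  have "\<bar>f x * g x\<bar> \<le> (f x)\<^sup>2 + (g x)\<^sup>2" for x
  proof -
    have "2 * (\<bar>f x\<bar> * \<bar>g x\<bar>) \<le> (f x)\<^sup>2 + (g x)\<^sup>2"
      using sum_squares_bound[of "\<bar>f x\<bar>" "\<bar>g x\<bar>"] by simp
    then show ?thesis by (simp add: abs_mult) (smt (verit) mult_nonneg_nonneg)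
  qed
  then show "AE x in M. norm (f x * g x) \<le> norm ((f x)\<^sup>2 + (g x)\<^sup>2)" by simp
qed

lemma square_integrable_cmult:
  "square_integrable M f \<Longrightarrow> square_integrable M (\<lambda>x. c * f x)"
  by (auto simp: square_integrable_def power_mult_distrib)

lemma square_integrable_add:
  assumes "square_integrable M f" "square_integrable M g"
  shows "square_integrable M (\<lambda>x. f x + g x)"
  using assms square_integrable_mult[OF assms]
  by (auto simp: square_integrable_def power2_sum mult.assoc)

lemma square_integrable_sum:
  assumes "\<And>i. i \<in> I \<Longrightarrow> square_integrable M (f i)"
  shows "square_integrable M (\<lambda>x. \<Sum>i\<in>I. f i x)"
  using assms
proof (induction I rule: infinite_finite_induct)
  case (insert i I)
  then show ?case by (simp add: square_integrable_add)
qed (simp_all add: square_integrable_def)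

lemma (in finite_measure) square_integrable_const: "square_integrable M (\<lambda>_. c)"
  by (simp add: square_integrable_def)

lemma (in finite_measure) square_integrable_integrable:
  "square_integrable M f \<Longrightarrow> integrable M f"
  by (auto simp: square_integrable_def intro: square_integrable_imp_integrable)

lemma integral_double_sum:
  fixes f :: "nat \<Rightarrow> nat \<Rightarrow> 'a \<Rightarrow> real"
  assumes "\<And>j k. j < p \<Longrightarrow> k < q \<Longrightarrow> integrable M (f j k)"
  shows "(\<integral>x. (\<Sum>j<p. \<Sum>k<q. f j k x) \<partial>M) = (\<Sum>j<p. \<Sum>k<q. \<integral>x. f j k x \<partial>M)"
proof -
  have "(\<integral>x. (\<Sum>j<p. \<Sum>k<q. f j k x) \<partial>M) = (\<Sum>j<p. \<integral>x. (\<Sum>k<q. f j k x) \<partial>M)"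
    using assms by (intro Bochner_Integration.integral_sum Bochner_Integration.integrable_sum) auto
  also have "\<dots> = (\<Sum>j<p. \<Sum>k<q. \<integral>x. f j k x \<partial>M)"
    using assms by (intro sum.cong Bochner_Integration.integral_sum) auto
  finally show ?thesis .
qed

text \<open>Merging the indices in \<open>K\<close> into one random tuple leaves two independent
  random elements, of which \<open>f\<close> and \<open>g\<close> are functions. In the martingale
  argument \<open>K\<close> is the past and \<open>l\<close> the present.\<close>

lemma (in prob_space) indep_vars_functions_of_disjoint:
  assumes ind: "indep_vars N Z I" and sub: "K \<subseteq> I" "l \<in> I" "l \<notin> K"
    and f: "f \<in> borel_measurable (PiM K N)" and g: "g \<in> borel_measurable (N l)"
  shows "indep_var borel (\<lambda>\<omega>. f (\<lambda>i\<in>K. Z i \<omega>)) borel (\<lambda>\<omega>. g (Z l \<omega>))"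
proof -
  have "indep_var (PiM K N) (\<lambda>\<omega>. \<lambda>i\<in>K. Z i \<omega>) (PiM {l} N) (\<lambda>\<omega>. \<lambda>i\<in>{l}. Z i \<omega>)"
    using sub by (intro indep_var_restrict[OF ind]) auto
  moreover have "(\<lambda>z. g (z l)) \<in> borel_measurable (PiM {l} N)"
    using g by (rule measurable_compose[rotated]) simp
  ultimately show ?thesis
    using indep_var_compose[OF _ f, of "\<lambda>\<omega>. \<lambda>i\<in>K. Z i \<omega>" "PiM {l} N" "\<lambda>\<omega>. \<lambda>i\<in>{l}. Z i \<omega>" "\<lambda>z. g (z l)" borel]
    by (simp add: comp_def)
qed

text \<open>In general a product of two such functions is only integrable. Under independence its
  square is a product of two independent integrable squares, so square integrability survives
  without fourth moments.\<close>

lemma (in prob_space)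
  fixes f g :: "'a \<Rightarrow> real"
  assumes "indep_var borel f borel g" "square_integrable M f" "square_integrable M g"
  shows square_integrable_mult_indep: "square_integrable M (\<lambda>x. f x * g x)"
    and expectation_mult_indep: "expectation (\<lambda>x. f x * g x) = expectation f * expectation g"
proof -
  have "indep_var borel (\<lambda>x. (f x)\<^sup>2) borel (\<lambda>x. (g x)\<^sup>2)"
    using indep_var_compose[OF assms(1), of "\<lambda>x. x\<^sup>2" borel "\<lambda>x. x\<^sup>2" borel] by (simp add: comp_def)
  from indep_var_integrable[OF this] show "square_integrable M (\<lambda>x. f x * g x)"
    using assms(2,3) by (auto simp: square_integrable_def power_mult_distrib)
  show "expectation (\<lambda>x. f x * g x) = expectation f * expectation g"
    using assms by (intro indep_var_lebesgue_integral square_integrable_integrable)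
qed

section \<open>Pair sums of centred independent vectors\<close>

text \<open>Used below with \<open>Z i\<close> the vector W_i - \<beta> and \<open>B\<close> its
  covariance matrix A - \<beta> \<beta>^T; of the common law only this matrix is retained.\<close>

locale centred_independent_vectors = prob_space M
  for M :: "'a measure" +
  fixes n p :: nat
    and Z :: "nat \<Rightarrow> 'a \<Rightarrow> nat \<Rightarrow> real"
    and B :: "nat \<Rightarrow> nat \<Rightarrow> real"
  assumes indep: "indep_vars (\<lambda>_. vec_space p) Z {..<n}"
    and square_int: "\<And>i j. i < n \<Longrightarrow> j < p \<Longrightarrow> square_integrable M (\<lambda>\<omega>. Z i \<omega> j)"
    and centred: "\<And>i j. i < n \<Longrightarrow> j < p \<Longrightarrow> expectation (\<lambda>\<omega>. Z i \<omega> j) = 0"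
    and second_moment: "\<And>i j k. i < n \<Longrightarrow> j < p \<Longrightarrow> k < p \<Longrightarrow>
          expectation (\<lambda>\<omega>. Z i \<omega> j * Z i \<omega> k) = B j k"
begin

definition partial_sum :: "nat \<Rightarrow> nat \<Rightarrow> 'a \<Rightarrow> real" where
  "partial_sum m j \<omega> = (\<Sum>i<m. Z i \<omega> j)"

text \<open>The inner products of Z_i' and Z_i over all pairs i' < i < m, grouped by the larger
  index: each increment pairs the past sum with a fresh vector.\<close>

definition pair_sum :: "nat \<Rightarrow> 'a \<Rightarrow> real" where
  "pair_sum m \<omega> = (\<Sum>i<m. \<Sum>j<p. partial_sum i j \<omega> * Z i \<omega> j)"

lemma partial_sum_Suc: "partial_sum (Suc m) j \<omega> = partial_sum m j \<omega> + Z m \<omega> j"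
  by (simp add: partial_sum_def)

lemma pair_sum_Suc:
  "pair_sum (Suc m) \<omega> = pair_sum m \<omega> + (\<Sum>j<p. partial_sum m j \<omega> * Z m \<omega> j)"
  by (simp add: pair_sum_def)

text \<open>Sums up to \<open>m\<close> are functions of the vectors before \<open>m\<close>, hence
  independent of \<open>Z m\<close>. The three forms serve, in this order, the second moment of an
  increment, its square integrability and its orthogonality to the past.\<close>

lemma
  assumes "m < n" "j < p" "k < p"
  shows indep_past_products:
      "indep_var borel (\<lambda>\<omega>. partial_sum m j \<omega> * partial_sum m k \<omega>) borel (\<lambda>\<omega>. Z m \<omega> j * Z m \<omega> k)"
    and indep_past_sum: "indep_var borel (partial_sum m j) borel (\<lambda>\<omega>. Z m \<omega> k)"
    and indep_past_pairs:
      "indep_var borel (\<lambda>\<omega>. pair_sum m \<omega> * partial_sum m j \<omega>) borel (\<lambda>\<omega>. Z m \<omega> k)"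
proof -
  let ?P = "Pi\<^sub>M {..<m} (\<lambda>_. vec_space p)"
  note past = indep_vars_functions_of_disjoint[OF indep, of "{..<m}" m]
  have coord: "(\<lambda>z. z i l) \<in> borel_measurable ?P" if "i < m" "l < p" for i l
    using that by (intro measurable_compose[OF measurable_component_singleton[of i]]) auto
  \<comment> \<open>\<open>s\<close> and \<open>d\<close> are the partial and pair sums read as
    functions of a tuple of past vectors. Restricting the tuple to indices below \<open>m\<close> is
    harmless since no other index occurs.\<close>
  define s where "s i l z = (\<Sum>i'<i. z i' l)" for i l and z :: "nat \<Rightarrow> nat \<Rightarrow> real"
  define d where "d z = (\<Sum>i<m. \<Sum>l<p. s i l z * z i l)" for z :: "nat \<Rightarrow> nat \<Rightarrow> real"
  have s: "s i l \<in> borel_measurable ?P" if "i \<le> m" "l < p" for i l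
    unfolding s_def using that by (intro borel_measurable_sum coord) auto
  have d: "d \<in> borel_measurable ?P"
    unfolding d_def using s coord by (intro borel_measurable_sum borel_measurable_times) auto
  have Zl: "(\<lambda>v. v l) \<in> borel_measurable (vec_space p)" if "l < p" for l
    using that by simp
  have s_eq: "s i l (\<lambda>i\<in>{..<m}. Z i \<omega>) = partial_sum i l \<omega>" if "i \<le> m" for i l \<omega>
    unfolding s_def partial_sum_def using that by (intro sum.cong) auto
  have d_eq: "d (\<lambda>i\<in>{..<m}. Z i \<omega>) = pair_sum m \<omega>" for \<omega>
    unfolding d_def pair_sum_def by (intro sum.cong) (auto simp: s_eq)
  show "indep_var borel (\<lambda>\<omega>. partial_sum m j \<omega> * partial_sum m k \<omega>) borel (\<lambda>\<omega>. Z m \<omega> j * Z m \<omega> k)"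
    using past[OF _ _ _ borel_measurable_times[OF s s] borel_measurable_times[OF Zl Zl], of m j m k j k] assms
    by (simp add: s_eq)
  show "indep_var borel (partial_sum m j) borel (\<lambda>\<omega>. Z m \<omega> k)"
    using past[of "s m j" "\<lambda>v. v k"] assms by (simp add: s_eq s)
  show "indep_var borel (\<lambda>\<omega>. pair_sum m \<omega> * partial_sum m j \<omega>) borel (\<lambda>\<omega>. Z m \<omega> k)"
    using past[OF _ _ _ borel_measurable_times[OF d s] Zl, of m j k] assms by (simp add: s_eq d_eq)
qed

lemma square_integrable_partial_sum:
  "m \<le> n \<Longrightarrow> j < p \<Longrightarrow> square_integrable M (partial_sum m j)"
  unfolding partial_sum_def[abs_def] by (intro square_integrable_sum square_int) auto

text \<open>The past sum and the fresh vector are independent, so their products are square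
  integrable although only second moments are available.\<close>

lemma square_integrable_increment:
  assumes "m < n"
  shows "square_integrable M (\<lambda>\<omega>. \<Sum>j<p. partial_sum m j \<omega> * Z m \<omega> j)"
  using assms
  by (intro square_integrable_sum square_integrable_mult_indep indep_past_sum
      square_integrable_partial_sum square_int) auto

lemma square_integrable_pair_sum: "m \<le> n \<Longrightarrow> square_integrable M (pair_sum m)"
  unfolding pair_sum_def[abs_def]
  by (rule square_integrable_sum) (auto intro: square_integrable_increment)

text \<open>Second moments of independent centred vectors add: each cross term factors through the
  mean of the fresh vector, which is zero.\<close>

lemma expectation_partial_sum_mult:
  assumes "m \<le> n" "j < p" "k < p"
  shows "expectation (\<lambda>\<omega>. partial_sum m j \<omega> * partial_sum m k \<omega>) = real m * B j k"
  using assms(1)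
proof (induction m)
  case 0
  then show ?case by (simp add: partial_sum_def)
next
  case (Suc m)
  note sq = square_integrable_partial_sum[of m] square_int[of m]
  note cross = expectation_mult_indep[OF indep_past_sum[of m], of j k]
    expectation_mult_indep[OF indep_past_sum[of m], of k j]
  have int: "integrable M (\<lambda>\<omega>. partial_sum m j \<omega> * partial_sum m k \<omega>)"
    "integrable M (\<lambda>\<omega>. partial_sum m j \<omega> * Z m \<omega> k)"
    "integrable M (\<lambda>\<omega>. partial_sum m k \<omega> * Z m \<omega> j)"
    "integrable M (\<lambda>\<omega>. Z m \<omega> j * Z m \<omega> k)"
    using Suc.prems assms(2,3) by (auto intro!: square_integrable_mult sq)
  have "expectation (\<lambda>\<omega>. partial_sum (Suc m) j \<omega> * partial_sum (Suc m) k \<omega>) =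
    expectation (\<lambda>\<omega>. partial_sum m j \<omega> * partial_sum m k \<omega> + partial_sum m j \<omega> * Z m \<omega> k
       + partial_sum m k \<omega> * Z m \<omega> j + Z m \<omega> j * Z m \<omega> k)"
    by (simp add: partial_sum_Suc algebra_simps)
  also have "\<dots> = real m * B j k + B j k"
    using Suc assms(2,3) int cross by (simp add: sq centred second_moment)
  finally show ?case by (simp add: algebra_simps)
qed

text \<open>With \<open>b\<close> = \<beta> this controls the linear part of the Hoeffding
  decomposition.\<close>

lemma expectation_linear_form_sq:
  "expectation (\<lambda>\<omega>. (\<Sum>j<p. b j * partial_sum n j \<omega>)\<^sup>2) =
   real n * (\<Sum>j<p. \<Sum>k<p. b j * b k * B j k)"
proof -
  have int: "integrable M (\<lambda>\<omega>. partial_sum n j \<omega> * partial_sum n k \<omega>)" if "j < p" "k < p" for j k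
    using that by (intro square_integrable_mult square_integrable_partial_sum) auto
  have "expectation (\<lambda>\<omega>. (\<Sum>j<p. b j * partial_sum n j \<omega>)\<^sup>2) =
    expectation (\<lambda>\<omega>. \<Sum>j<p. \<Sum>k<p. b j * b k * (partial_sum n j \<omega> * partial_sum n k \<omega>))"
    by (simp add: power2_eq_square sum_product algebra_simps)
  also have "\<dots> = (\<Sum>j<p. \<Sum>k<p. b j * b k * (real n * B j k))"
    by (subst integral_double_sum) (simp_all add: int expectation_partial_sum_mult)
  finally show ?thesis by (simp add: sum_distrib_left algebra_simps)
qed

text \<open>\<^const>\<open>pair_sum\<close> is a martingale in \<open>m\<close>, so its increments are orthogonal.\<close>

lemma expectation_pair_sum_sq:
  assumes "m \<le> n"
  shows "expectation (\<lambda>\<omega>. (pair_sum m \<omega>)\<^sup>2) =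
    real m * (real m - 1) / 2 * (\<Sum>j<p. \<Sum>k<p. (B j k)\<^sup>2)"
  using assms
proof (induction m)
  case 0
  then show ?case by (simp add: pair_sum_def)
next
  case (Suc m)
  then have m: "m < n" by simp
  let ?inc = "\<lambda>\<omega>. \<Sum>j<p. partial_sum m j \<omega> * Z m \<omega> j"
  have sqD: "square_integrable M (pair_sum m)" and sqI: "square_integrable M ?inc"
    using m by (auto intro: square_integrable_pair_sum square_integrable_increment)
  have sqS: "square_integrable M (partial_sum m j)" if "j < p" for j
    using m that by (intro square_integrable_partial_sum) auto
  \<comment> \<open>The past factor is a product of two square-integrable functions, hence
    integrable; that suffices to split off the independent, centred \<open>Z m\<close>.\<close>
  have cross: "expectation (\<lambda>\<omega>. pair_sum m \<omega> * partial_sum m j \<omega> * Z m \<omega> j) = 0"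
    "integrable M (\<lambda>\<omega>. pair_sum m \<omega> * partial_sum m j \<omega> * Z m \<omega> j)" if "j < p" for j
    using indep_var_lebesgue_integral[OF indep_past_pairs[OF m that that]]
      indep_var_integrable[OF indep_past_pairs[OF m that that]]
      square_integrable_mult[OF sqD sqS[OF that]]
      square_integrable_integrable[OF square_int[OF m that]] m that
    by (simp_all add: centred)
  have "expectation (\<lambda>\<omega>. pair_sum m \<omega> * ?inc \<omega>) =
      expectation (\<lambda>\<omega>. \<Sum>j<p. pair_sum m \<omega> * partial_sum m j \<omega> * Z m \<omega> j)"
    by (simp add: sum_distrib_left mult.assoc)
  also have "\<dots> = 0" using cross by simp
  finally have orth: "expectation (\<lambda>\<omega>. pair_sum m \<omega> * ?inc \<omega>) = 0" .
  \<comment> \<open>Past and present separate by independence: the past contributes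
    \<open>real m * B j k\<close> and the present another \<open>B j k\<close>.\<close>
  have prods: "expectation (\<lambda>\<omega>. (partial_sum m j \<omega> * partial_sum m k \<omega>) * (Z m \<omega> j * Z m \<omega> k))
        = real m * (B j k)\<^sup>2"
    "integrable M (\<lambda>\<omega>. (partial_sum m j \<omega> * partial_sum m k \<omega>) * (Z m \<omega> j * Z m \<omega> k))"
    if "j < p" "k < p" for j k
  proof -
    note ind = indep_past_products[OF m that]
    have i1: "integrable M (\<lambda>\<omega>. partial_sum m j \<omega> * partial_sum m k \<omega>)"
      and i2: "integrable M (\<lambda>\<omega>. Z m \<omega> j * Z m \<omega> k)"
      using m that by (auto intro!: square_integrable_mult sqS square_int)
    show "expectation (\<lambda>\<omega>. (partial_sum m j \<omega> * partial_sum m k \<omega>) * (Z m \<omega> j * Z m \<omega> k))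
        = real m * (B j k)\<^sup>2"
      using indep_var_lebesgue_integral[OF ind i1 i2] m that
      by (simp add: expectation_partial_sum_mult second_moment power2_eq_square)
    show "integrable M (\<lambda>\<omega>. (partial_sum m j \<omega> * partial_sum m k \<omega>) * (Z m \<omega> j * Z m \<omega> k))"
      by (rule indep_var_integrable[OF ind i1 i2])
  qed
  have "expectation (\<lambda>\<omega>. (?inc \<omega>)\<^sup>2) = expectation (\<lambda>\<omega>. \<Sum>j<p. \<Sum>k<p.
      (partial_sum m j \<omega> * partial_sum m k \<omega>) * (Z m \<omega> j * Z m \<omega> k))"
    by (simp add: power2_eq_square sum_product algebra_simps)
  also have "\<dots> = real m * (\<Sum>j<p. \<Sum>k<p. (B j k)\<^sup>2)"
    by (subst integral_double_sum) (simp_all add: prods sum_distrib_left)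
  finally have inc: "expectation (\<lambda>\<omega>. (?inc \<omega>)\<^sup>2) = real m * (\<Sum>j<p. \<Sum>k<p. (B j k)\<^sup>2)" .
  have "expectation (\<lambda>\<omega>. (pair_sum (Suc m) \<omega>)\<^sup>2) =
    expectation (\<lambda>\<omega>. (pair_sum m \<omega>)\<^sup>2 + (?inc \<omega>)\<^sup>2 + 2 * (pair_sum m \<omega> * ?inc \<omega>))"
    by (simp add: pair_sum_Suc power2_sum mult.assoc)
  also have "\<dots> = expectation (\<lambda>\<omega>. (pair_sum m \<omega>)\<^sup>2) + expectation (\<lambda>\<omega>. (?inc \<omega>)\<^sup>2)"
    using square_integrable_mult[OF sqD sqI] square_integrable_square[OF sqD]
      square_integrable_square[OF sqI] orth by simp
  \<comment> \<open>The induction closes with m (m - 1) / 2 + m = (m + 1) m / 2.\<close>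
  also have "\<dots> = real (Suc m) * (real (Suc m) - 1) / 2 * (\<Sum>j<p. \<Sum>k<p. (B j k)\<^sup>2)"
    using Suc inc by (simp add: field_simps)
  finally show ?case .
qed

end

section \<open>Algebra of off-diagonal sums\<close>

lemma sum_off_diagonal:
  fixes w :: "nat \<Rightarrow> real"
  shows "(\<Sum>i<n. \<Sum>i'\<in>{..<n} - {i}. w i * w i') = (\<Sum>i<n. w i)\<^sup>2 - (\<Sum>i<n. (w i)\<^sup>2)"
proof -
  have "(\<Sum>i'\<in>{..<n} - {i}. w i * w i') = w i * (\<Sum>i'<n. w i') - (w i)\<^sup>2" if "i < n" for i
    using that by (simp add: sum_diff1 sum_distrib_left power2_eq_square)
  then show ?thesis
    by (simp add: sum_subtractf sum_distrib_right[symmetric] power2_eq_square)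
qed

text \<open>Pairs are listed by their larger index, to match \<open>pair_sum\<close>.\<close>

lemma square_of_sum_eq_pairs:
  fixes v :: "nat \<Rightarrow> real"
  shows "(\<Sum>i<n. v i)\<^sup>2 = (\<Sum>i<n. (v i)\<^sup>2) + 2 * (\<Sum>i<n. (\<Sum>i'<i. v i') * v i)"
  by (induction n) (simp_all add: power2_sum algebra_simps)

text \<open>The Hoeffding decomposition in one coordinate. Each index meets n - 1 others, in either
  position, whence the factor 2 (n - 1) of the linear term.\<close>

lemma sum_off_diagonal_centred:
  fixes v :: "nat \<Rightarrow> real" and b :: real
  shows "(\<Sum>i<n. \<Sum>i'\<in>{..<n} - {i}. (v i + b) * (v i' + b)) =
    2 * (\<Sum>i<n. (\<Sum>i'<i. v i') * v i) + 2 * (real n - 1) * b * (\<Sum>i<n. v i)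
      + real n * (real n - 1) * b\<^sup>2"
proof -
  have "(\<Sum>i<n. v i + b) = (\<Sum>i<n. v i) + real n * b"
    by (simp add: sum.distrib)
  moreover have "(\<Sum>i<n. (v i + b)\<^sup>2) = (\<Sum>i<n. (v i)\<^sup>2) + 2 * b * (\<Sum>i<n. v i) + real n * b\<^sup>2"
    by (simp add: sum.distrib power2_sum sum_distrib_left algebra_simps)
  ultimately show ?thesis
    unfolding sum_off_diagonal using square_of_sum_eq_pairs[of v n]
    by (simp add: algebra_simps power2_eq_square)
qed

section \<open>Measurability and moments in the linear model\<close>

context linear_model_sample
begin

abbreviation covariate_algebra :: "nat \<Rightarrow> 'a measure" where
  "covariate_algebra i \<equiv> vimage_algebra (space M) (row p X i) (vec_space p)"

lemma row_eq: "j < p \<Longrightarrow> row p X i \<omega> j = X i j \<omega>"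
  by (simp add: row_def)

lemma observation_measurable:
  assumes "i < n"
  shows "(\<lambda>\<omega>. (row p X i \<omega>, Y i \<omega>)) \<in> measurable M (vec_space p \<Otimes>\<^sub>M borel)"
  using independent assms by (auto simp: indep_vars_def)

lemma row_measurable: "i < n \<Longrightarrow> row p X i \<in> measurable M (vec_space p)"
  using measurable_compose[OF observation_measurable measurable_fst] by simp

lemma Y_measurable: "i < n \<Longrightarrow> Y i \<in> borel_measurable M"
  using measurable_compose[OF observation_measurable measurable_snd] by simp

lemma X_measurable_covariate_algebra:
  assumes "i < n" "j < p"
  shows "X i j \<in> borel_measurable (covariate_algebra i)"
proof -
  have "row p X i \<in> measurable (covariate_algebra i) (vec_space p)"
    using measurable_space[OF row_measurable[OF assms(1)]]
    by (intro measurable_vimage_algebra1) auto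
  from measurable_compose[OF this measurable_component_singleton[of j]] assms(2)
  show ?thesis by (simp add: row_eq)
qed

lemma covariate_subalgebra:
  assumes "i < n"
  shows "finite_measure_subalgebra M (covariate_algebra i)"
proof
  have "sets (covariate_algebra i) \<subseteq> sets M"
    using measurable_sets[OF row_measurable[OF assms]]
    by (subst sets_vimage_algebra2) (auto simp: measurable_space[OF row_measurable[OF assms]])
  then show "subalgebra M (covariate_algebra i)"
    by (simp add: subalgebra_def)
qed

lemma measurable_from_covariate_algebra:
  assumes "i < n" "f \<in> borel_measurable (covariate_algebra i)"
  shows "f \<in> borel_measurable M"
  using finite_measure_subalgebra.subalg[OF covariate_subalgebra[OF assms(1)]] assms(2)
  by (rule measurable_from_subalg)

lemma square_integrable_X: "i < n \<Longrightarrow> j < p \<Longrightarrow> square_integrable M (X i j)"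
  using measurable_from_covariate_algebra[OF _ X_measurable_covariate_algebra]
    covariate_square_integrable
  by (simp add: square_integrable_def)

definition signal :: "nat \<Rightarrow> 'a \<Rightarrow> real" where
  "signal i \<omega> = (\<Sum>j<p. \<beta> j * X i j \<omega>)"

lemma Y_eq: "i < n \<Longrightarrow> \<omega> \<in> space M \<Longrightarrow> Y i \<omega> = signal i \<omega> + \<epsilon> i \<omega>"
  by (simp add: linear_model signal_def)

lemma signal_measurable_covariate_algebra:
  "i < n \<Longrightarrow> signal i \<in> borel_measurable (covariate_algebra i)"
  unfolding signal_def[abs_def]
  by (intro borel_measurable_sum borel_measurable_times X_measurable_covariate_algebra) auto

lemma square_integrable_signal: "i < n \<Longrightarrow> square_integrable M (signal i)"
  unfolding signal_def[abs_def]
  by (intro square_integrable_sum square_integrable_cmult square_integrable_X) auto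

text \<open>Measurability of the noise is inherited from \<open>Y i\<close> and the covariates
  through \<epsilon> = Y - \<beta> \<bullet> X on the space.\<close>

lemma square_integrable_noise:
  assumes "i < n"
  shows "square_integrable M (\<epsilon> i)"
proof -
  have "(\<lambda>\<omega>. Y i \<omega> - signal i \<omega>) \<in> borel_measurable M"
    using assms Y_measurable square_integrable_measurable[OF square_integrable_signal] by auto
  then have "\<epsilon> i \<in> borel_measurable M"
    by (rule measurable_cong[THEN iffD1, rotated]) (simp add: Y_eq assms)
  then show ?thesis
    using noise_square_integrable assms by (simp add: square_integrable_def)
qed

lemma expectation_covariate_product:
  assumes "i < n" "j < p" "k < p"
  shows "expectation (\<lambda>\<omega>. X i j \<omega> * X i k \<omega>) = (if j = k then 1 else 0)"
  using covariate_covariance[OF assms] covariate_mean assms by (simp add: covariance_def)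

text \<open>A function of the covariates can be pulled out of the conditional expectation of the
  noise, which vanishes almost everywhere.\<close>

lemma noise_orthogonal:
  assumes i: "i < n" and f: "f \<in> borel_measurable (covariate_algebra i)"
    and int: "integrable M (\<lambda>\<omega>. f \<omega> * \<epsilon> i \<omega>)"
  shows "expectation (\<lambda>\<omega>. f \<omega> * \<epsilon> i \<omega>) = 0"
proof -
  interpret finite_measure_subalgebra M "covariate_algebra i"
    using i by (rule covariate_subalgebra)
  have e: "\<epsilon> i \<in> borel_measurable M"
    using i square_integrable_noise by (simp add: square_integrable_def)
  have "expectation (\<lambda>\<omega>. f \<omega> * \<epsilon> i \<omega>) =
      expectation (\<lambda>\<omega>. f \<omega> * real_cond_exp M (covariate_algebra i) (\<epsilon> i) \<omega>)"
    by (rule real_cond_exp_intg(2)[symmetric, OF int f e])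
  also have "\<dots> = expectation (\<lambda>_. 0)"
    using noise_cond_mean[OF i] measurable_from_covariate_algebra[OF i f]
    by (intro integral_cong_AE) auto
  finally show ?thesis by simp
qed

text \<open>The product with the squared noise is not assumed integrable: its absolute moment is
  computed as a nonnegative integral first.\<close>

lemma
  assumes i: "i < n" and f: "f \<in> borel_measurable (covariate_algebra i)"
    and int: "integrable M f"
  shows integrable_mult_noise_sq: "integrable M (\<lambda>\<omega>. f \<omega> * (\<epsilon> i \<omega>)\<^sup>2)"
    and expectation_mult_noise_sq: "expectation (\<lambda>\<omega>. f \<omega> * (\<epsilon> i \<omega>)\<^sup>2) = \<sigma>\<^sup>2 * expectation f"
proof -
  interpret finite_measure_subalgebra M "covariate_algebra i"
    using i by (rule covariate_subalgebra)
  let ?F = "covariate_algebra i"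
  let ?N = "nn_cond_exp M ?F (\<lambda>\<omega>. ennreal ((\<epsilon> i \<omega>)\<^sup>2))"
  have e [measurable]: "\<epsilon> i \<in> borel_measurable M"
    using i square_integrable_noise by (simp add: square_integrable_def)
  have f [measurable]: "f \<in> borel_measurable ?F" and fM [measurable]: "f \<in> borel_measurable M"
    using f measurable_from_covariate_algebra[OF i f] by simp_all
  \<comment> \<open>The factor 1 gives equality of total integrals, so \<open>?N\<close> is finite
    almost everywhere. This matters because \<open>enn2real\<close> would send an infinite value to
    0.\<close>
  have "(\<integral>\<^sup>+\<omega>. 1 * ?N \<omega> \<partial>M) = (\<integral>\<^sup>+\<omega>. 1 * ennreal ((\<epsilon> i \<omega>)\<^sup>2) \<partial>M)"
    by (rule nn_cond_exp_intg) auto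
  also have "\<dots> < \<infinity>"
    using noise_square_integrable[OF i] by (simp add: integrable_iff_bounded)
  finally have "AE \<omega> in M. ?N \<omega> \<noteq> \<infinity>"
    by (intro nn_integral_PInf_AE) auto
  \<comment> \<open>\<open>real_cond_exp\<close> subtracts the conditional expectation of the
    negative part, which for a square is that of 0.\<close>
  moreover have "AE \<omega> in M. nn_cond_exp M ?F (\<lambda>_. 0) \<omega> = 0"
    using nn_cond_exp_F_meas[of "\<lambda>_. 0"] by (auto elim: eventually_mono)
  ultimately have "AE \<omega> in M. ?N \<omega> = ennreal (\<sigma>\<^sup>2)"
    using noise_cond_variance[OF i]
  proof eventually_elim
    case (elim \<omega>)
    then have "enn2real (?N \<omega>) = \<sigma>\<^sup>2"
      by (simp add: real_cond_exp_def ennreal_neg)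
    then show ?case
      using elim(1) by (metis ennreal_enn2real_if infinity_ennreal_def)
  qed
  note N = this
  have "(\<integral>\<^sup>+\<omega>. ennreal (norm (f \<omega> * (\<epsilon> i \<omega>)\<^sup>2)) \<partial>M) =
      (\<integral>\<^sup>+\<omega>. ennreal \<bar>f \<omega>\<bar> * ennreal ((\<epsilon> i \<omega>)\<^sup>2) \<partial>M)"
    by (simp add: abs_mult ennreal_mult)
  also have "\<dots> = (\<integral>\<^sup>+\<omega>. ennreal \<bar>f \<omega>\<bar> * ?N \<omega> \<partial>M)"
    by (rule nn_cond_exp_intg[symmetric]) auto
  also have "\<dots> = (\<integral>\<^sup>+\<omega>. ennreal \<bar>f \<omega>\<bar> * ennreal (\<sigma>\<^sup>2) \<partial>M)"
    using N by (intro nn_integral_cong_AE) auto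
  also have "\<dots> = (\<integral>\<^sup>+\<omega>. ennreal \<bar>f \<omega>\<bar> \<partial>M) * ennreal (\<sigma>\<^sup>2)"
    by (rule nn_integral_multc) auto
  also have "\<dots> < \<infinity>"
    using int by (simp add: integrable_iff_bounded ennreal_mult_less_top)
  finally show int2: "integrable M (\<lambda>\<omega>. f \<omega> * (\<epsilon> i \<omega>)\<^sup>2)"
    by (intro integrableI_bounded) auto
  have "expectation (\<lambda>\<omega>. f \<omega> * (\<epsilon> i \<omega>)\<^sup>2) =
      expectation (\<lambda>\<omega>. f \<omega> * real_cond_exp M ?F (\<lambda>\<omega>. (\<epsilon> i \<omega>)\<^sup>2) \<omega>)"
    by (rule real_cond_exp_intg(2)[symmetric, OF int2]) auto
  also have "\<dots> = expectation (\<lambda>\<omega>. f \<omega> * \<sigma>\<^sup>2)"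
    using noise_cond_variance[OF i] by (intro integral_cong_AE) auto
  finally show "expectation (\<lambda>\<omega>. f \<omega> * (\<epsilon> i \<omega>)\<^sup>2) = \<sigma>\<^sup>2 * expectation f"
    by simp
qed

text \<open>Substituting the model for \<open>Y i\<close> leaves products of two covariates, from
  which the identity covariance selects \<beta>_j, and a noise term killed by
  \<open>noise_orthogonal\<close>. Second moments suffice.\<close>

lemma
  assumes "i < n" "j < p"
  shows integrable_W: "integrable M (W X Y i j)"
    and expectation_W: "expectation (W X Y i j) = \<beta> j"
proof -
  note sq = square_integrable_X square_integrable_noise
  have W: "W X Y i j \<omega> = (\<Sum>k<p. \<beta> k * (X i j \<omega> * X i k \<omega>)) + X i j \<omega> * \<epsilon> i \<omega>"
    if "\<omega> \<in> space M" for \<omega>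
    using assms that by (simp add: W_def linear_model sum_distrib_left algebra_simps)
  have int: "integrable M (\<lambda>\<omega>. X i j \<omega> * X i k \<omega>)" if "k < p" for k
    using assms that by (intro square_integrable_mult sq)
  have int_noise: "integrable M (\<lambda>\<omega>. X i j \<omega> * \<epsilon> i \<omega>)"
    using assms by (intro square_integrable_mult sq)
  show "integrable M (W X Y i j)"
    using int int_noise
    by (subst Bochner_Integration.integrable_cong[OF refl W])
      (auto intro!: Bochner_Integration.integrable_add Bochner_Integration.integrable_sum)
  have "expectation (W X Y i j) =
      expectation (\<lambda>\<omega>. (\<Sum>k<p. \<beta> k * (X i j \<omega> * X i k \<omega>)) + X i j \<omega> * \<epsilon> i \<omega>)"
    by (rule Bochner_Integration.integral_cong[OF refl W])
  also have "\<dots> = expectation (\<lambda>\<omega>. \<Sum>k<p. \<beta> k * (X i j \<omega> * X i k \<omega>))"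
    using int int_noise noise_orthogonal[OF assms(1) X_measurable_covariate_algebra[OF assms] int_noise]
    by (subst Bochner_Integration.integral_add) (auto intro!: Bochner_Integration.integrable_sum)
  also have "\<dots> = (\<Sum>k<p. \<beta> k * (if j = k then 1 else 0))"
    using assms int
    by (subst Bochner_Integration.integral_sum) (auto simp: expectation_covariate_product)
  also have "\<dots> = \<beta> j"
    using assms by (simp add: if_distrib sum.delta' cong: if_cong)
  finally show "expectation (W X Y i j) = \<beta> j" .
qed

text \<open>The product is one fixed function \<open>h\<close> of the observation, so its integral
  depends only on the common law. This carries \<open>A_matrix\<close>, defined at observation 0, to
  every \<open>i\<close>.\<close>

lemma
  assumes "i < n" "j < p" "k < p"
  shows integrable_W_product_iff:
      "integrable M (\<lambda>\<omega>. W X Y i j \<omega> * W X Y i k \<omega>) \<longleftrightarrow>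
       integrable M (\<lambda>\<omega>. W X Y 0 j \<omega> * W X Y 0 k \<omega>)"
    and expectation_W_product:
      "expectation (\<lambda>\<omega>. W X Y i j \<omega> * W X Y i k \<omega>) = A_matrix M X Y j k"
proof -
  define h where "h v = (fst v j * snd v) * (fst v k * snd v)" for v :: "(nat \<Rightarrow> real) \<times> real"
  have h: "h \<in> borel_measurable (vec_space p \<Otimes>\<^sub>M borel)"
  proof -
    have "(\<lambda>v. fst v l) \<in> borel_measurable (vec_space p \<Otimes>\<^sub>M (borel :: real measure))" if "l < p" for l
      using that by (intro measurable_compose[OF measurable_fst]) simp
    moreover have "snd \<in> borel_measurable (vec_space p \<Otimes>\<^sub>M (borel :: real measure))"
      by (rule measurable_snd)
    ultimately show ?thesis
      unfolding h_def[abs_def] using assms by (intro borel_measurable_times) auto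
  qed
  have W: "W X Y i' j \<omega> * W X Y i' k \<omega> = h (row p X i' \<omega>, Y i' \<omega>)" for i' \<omega>
    using assms by (simp add: W_def h_def row_eq)
  have n: "0 < n" using assms by simp
  note law = identically_distributed[OF assms(1) n]
  show "integrable M (\<lambda>\<omega>. W X Y i j \<omega> * W X Y i k \<omega>) \<longleftrightarrow>
       integrable M (\<lambda>\<omega>. W X Y 0 j \<omega> * W X Y 0 k \<omega>)"
    unfolding W integrable_distr_eq[OF observation_measurable[OF assms(1)] h, symmetric]
      integrable_distr_eq[OF observation_measurable[OF n] h, symmetric] law ..
  show "expectation (\<lambda>\<omega>. W X Y i j \<omega> * W X Y i k \<omega>) = A_matrix M X Y j k"
    unfolding A_matrix_def W integral_distr[OF observation_measurable[OF assms(1)] h, symmetric]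
      integral_distr[OF observation_measurable[OF n] h, symmetric] law ..
qed

end

section \<open>Quadratic forms and the mean squared error of the estimator\<close>

definition quadratic_form :: "nat \<Rightarrow> (nat \<Rightarrow> real) \<Rightarrow> (nat \<Rightarrow> nat \<Rightarrow> real) \<Rightarrow> real" where
  "quadratic_form p b C = (\<Sum>j<p. \<Sum>k<p. b j * b k * C j k)"

lemma frobenius_norm_sq: "(frobenius_norm p C)\<^sup>2 = (\<Sum>j<p. \<Sum>k<p. (C j k)\<^sup>2)"
  by (simp add: frobenius_norm_def sum_nonneg)

lemma signal_strength_nonneg: "0 \<le> signal_strength p b"
  by (simp add: signal_strength_def sum_nonneg)

lemma signal_strength_sq: "(signal_strength p b)\<^sup>2 = (\<Sum>j<p. \<Sum>k<p. (b j * b k)\<^sup>2)"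
  by (simp add: signal_strength_def power2_eq_square sum_product algebra_simps)

text \<open>Cauchy-Schwarz over index pairs, for the entries of b b^T and of \<open>C\<close>; the
  Frobenius norm of b b^T is \<open>signal_strength p b\<close>.\<close>

lemma quadratic_form_le: "quadratic_form p b C \<le> signal_strength p b * frobenius_norm p C"
proof -
  have "(quadratic_form p b C)\<^sup>2 = (\<Sum>x\<in>{..<p} \<times> {..<p}. (b (fst x) * b (snd x)) * C (fst x) (snd x))\<^sup>2"
    by (simp add: quadratic_form_def sum.cartesian_product case_prod_beta)
  also have "\<dots> \<le> (\<Sum>x\<in>{..<p} \<times> {..<p}. (b (fst x) * b (snd x))\<^sup>2) *
      (\<Sum>x\<in>{..<p} \<times> {..<p}. (C (fst x) (snd x))\<^sup>2)"
    by (rule Cauchy_Schwarz_ineq_sum)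
  also have "\<dots> = (signal_strength p b * frobenius_norm p C)\<^sup>2"
    by (simp add: power_mult_distrib frobenius_norm_sq signal_strength_sq sum.cartesian_product
        case_prod_beta)
  finally show ?thesis
    by (rule power2_le_imp_le) (simp add: signal_strength_nonneg frobenius_norm_def sum_nonneg)
qed

context linear_model_sample
begin

text \<open>Independence passes to W_i - \<beta>, a fixed measurable function of the observation;
  existence of the diagonal of A gives square integrability. The restriction to
  \<open>{..<p}\<close> places the values in the product space.\<close>

lemma centred_W_vectors:
  assumes A: "A_matrix_exists M p X Y"
  shows "centred_independent_vectors M n p (\<lambda>i \<omega>. \<lambda>j\<in>{..<p}. W X Y i j \<omega> - \<beta> j)
    (\<lambda>j k. A_matrix M X Y j k - \<beta> j * \<beta> k)"
proof
  have intWW: "integrable M (\<lambda>\<omega>. W X Y i j \<omega> * W X Y i k \<omega>)" if "i < n" "j < p" "k < p" for i j k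
    using A that integrable_W_product_iff[OF that] by (simp add: A_matrix_exists_def)
  define h where "h v = (\<lambda>j\<in>{..<p}. fst v j * snd v - \<beta> j)" for v :: "(nat \<Rightarrow> real) \<times> real"
  have h: "h \<in> measurable (vec_space p \<Otimes>\<^sub>M borel) (vec_space p)"
    unfolding h_def[abs_def]
  proof (rule measurable_restrict)
    fix l assume "l \<in> {..<p}"
    then have "(\<lambda>v. fst v l) \<in> borel_measurable (vec_space p \<Otimes>\<^sub>M (borel :: real measure))"
      by (intro measurable_compose[OF measurable_fst]) simp
    then show "(\<lambda>v. fst v l * snd v - \<beta> l) \<in> borel_measurable (vec_space p \<Otimes>\<^sub>M borel)"
      using measurable_snd by (intro borel_measurable_diff borel_measurable_times) auto
  qed
  have "h (row p X i \<omega>, Y i \<omega>) = (\<lambda>j\<in>{..<p}. W X Y i j \<omega> - \<beta> j)" for i \<omega>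
    by (auto simp: h_def W_def row_eq restrict_def)
  then show "indep_vars (\<lambda>_. vec_space p) (\<lambda>i \<omega>. \<lambda>j\<in>{..<p}. W X Y i j \<omega> - \<beta> j) {..<n}"
    using indep_vars_compose2[OF independent h] by simp
  fix i j assume i: "i < n" and j: "j < p"
  have sqW: "square_integrable M (W X Y i j)" if "j < p" for j
    using intWW[OF i that that] borel_measurable_integrable[OF integrable_W[OF i that]]
    by (simp add: square_integrable_def power2_eq_square)
  have "square_integrable M (\<lambda>\<omega>. W X Y i j \<omega> + - \<beta> j)"
    by (intro square_integrable_add sqW square_integrable_const j)
  then show "square_integrable M (\<lambda>\<omega>. (\<lambda>j\<in>{..<p}. W X Y i j \<omega> - \<beta> j) j)"
    using j by simp
  show "expectation (\<lambda>\<omega>. (\<lambda>j\<in>{..<p}. W X Y i j \<omega> - \<beta> j) j) = 0"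
    using i j by (simp add: integrable_W expectation_W prob_space)
  fix k assume k: "k < p"
  have "expectation (\<lambda>\<omega>. (W X Y i j \<omega> - \<beta> j) * (W X Y i k \<omega> - \<beta> k)) =
    expectation (\<lambda>\<omega>. W X Y i j \<omega> * W X Y i k \<omega> - \<beta> k * W X Y i j \<omega> - \<beta> j * W X Y i k \<omega> + \<beta> j * \<beta> k)"
    by (simp add: algebra_simps)
  also have "\<dots> = A_matrix M X Y j k - \<beta> j * \<beta> k"
    using i j k by (simp add: intWW integrable_W expectation_W expectation_W_product prob_space)
  finally show "expectation (\<lambda>\<omega>. (\<lambda>j\<in>{..<p}. W X Y i j \<omega> - \<beta> j) j * (\<lambda>j\<in>{..<p}. W X Y i j \<omega> - \<beta> j) k)
      = A_matrix M X Y j k - \<beta> j * \<beta> k"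
    using j k by simp
qed

text \<open>The degenerate and linear parts are bounded separately in terms of Cov W = A - \<beta>
  \<beta>^T, which is then replaced by A itself at no cost.\<close>

lemma
  assumes A: "A_matrix_exists M p X Y" and n: "2 \<le> n"
  defines "err \<equiv> \<lambda>\<omega>. naive_estimator n p X Y \<omega> - signal_strength p \<beta>"
  shows square_integrable_naive_error: "square_integrable M err"
    and expectation_naive_error_sq:
      "expectation (\<lambda>\<omega>. (err \<omega>)\<^sup>2) \<le>
         4 * (frobenius_norm p (A_matrix M X Y))\<^sup>2 / (real n * (real n - 1))
       + 8 * quadratic_form p \<beta> (A_matrix M X Y) / real n"
proof -
  let ?Z = "\<lambda>i \<omega>. \<lambda>j\<in>{..<p}. W X Y i j \<omega> - \<beta> j"
  let ?A = "A_matrix M X Y" and ?B = "\<lambda>j k. A_matrix M X Y j k - \<beta> j * \<beta> k"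
  interpret V: centred_independent_vectors M n p ?Z ?B
    using A by (rule centred_W_vectors)
  define L where "L \<omega> = (\<Sum>j<p. \<beta> j * V.partial_sum n j \<omega>)" for \<omega>
  define D where "D = V.pair_sum n"
  define N where "N = real n * (real n - 1)"
  have N: "N > 0" using n by (simp add: N_def)
  have sqD: "square_integrable M D"
    unfolding D_def by (rule V.square_integrable_pair_sum) simp
  have sqL: "square_integrable M L"
    unfolding L_def[abs_def]
    by (intro square_integrable_sum square_integrable_cmult V.square_integrable_partial_sum) auto
  \<comment> \<open>Each coordinate is decomposed with v_i = W_ij - \<beta>_j. The constant terms
    add up to \<open>N * signal_strength p \<beta>\<close>, which after division by \<open>N\<close>
    is the target.\<close>
  have err: "err \<omega> = 2 / N * D \<omega> + 2 / real n * L \<omega>" for \<omega>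
  proof -
    have "(\<Sum>i<n. \<Sum>i'\<in>{..<n} - {i}. W X Y i j \<omega> * W X Y i' j \<omega>) =
      2 * (\<Sum>i<n. V.partial_sum i j \<omega> * ?Z i \<omega> j)
      + 2 * (real n - 1) * (\<beta> j * V.partial_sum n j \<omega>) + N * (\<beta> j)\<^sup>2" if "j < p" for j
      using sum_off_diagonal_centred[of "\<lambda>i. W X Y i j \<omega> - \<beta> j" "\<beta> j" n] that
      by (simp add: V.partial_sum_def N_def mult.assoc)
    then have "(\<Sum>j<p. \<Sum>i<n. \<Sum>i'\<in>{..<n} - {i}. W X Y i j \<omega> * W X Y i' j \<omega>) =
      2 * (\<Sum>j<p. \<Sum>i<n. V.partial_sum i j \<omega> * ?Z i \<omega> j) + 2 * (real n - 1) * L \<omega> +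
      N * signal_strength p \<beta>"
      by (simp add: sum.distrib sum_distrib_left L_def signal_strength_def)
    moreover have "(\<Sum>j<p. \<Sum>i<n. V.partial_sum i j \<omega> * ?Z i \<omega> j) = D \<omega>"
      unfolding D_def V.pair_sum_def by (rule sum.swap)
    ultimately have "naive_estimator n p X Y \<omega> =
        1 / N * (2 * D \<omega> + 2 * (real n - 1) * L \<omega> + N * signal_strength p \<beta>)"
      by (simp add: naive_estimator_def N_def)
    moreover have "(real n - 1) / N = 1 / real n"
      using n by (simp add: N_def)
    moreover have "1 / N * (2 * D \<omega> + 2 * (real n - 1) * L \<omega> + N * signal_strength p \<beta>) =
        2 / N * D \<omega> + 2 * ((real n - 1) / N) * L \<omega> + signal_strength p \<beta>"
      using N by (simp add: field_simps)
    ultimately show ?thesis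
      by (simp add: err_def)
  qed
  show "square_integrable M err"
    unfolding err by (intro square_integrable_add square_integrable_cmult sqD sqL)
  then have "expectation (\<lambda>\<omega>. (err \<omega>)\<^sup>2) \<le>
      expectation (\<lambda>\<omega>. 8 / N\<^sup>2 * (D \<omega>)\<^sup>2 + 8 / (real n)\<^sup>2 * (L \<omega>)\<^sup>2)"
  proof (intro integral_mono square_integrable_square)
    show "integrable M (\<lambda>\<omega>. 8 / N\<^sup>2 * (D \<omega>)\<^sup>2 + 8 / (real n)\<^sup>2 * (L \<omega>)\<^sup>2)"
      using sqD sqL by (simp add: square_integrable_def)
    fix \<omega>
    \<comment> \<open>The constants 8 arise as 2 times the squared numerators 2 of the two
      coefficients.\<close>
    have "(a + b)\<^sup>2 \<le> 2 * a\<^sup>2 + 2 * b\<^sup>2" for a b :: real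
      using sum_squares_bound[of a b] by (simp add: power2_sum)
    from this[of "2 / N * D \<omega>" "2 / real n * L \<omega>"]
    show "(err \<omega>)\<^sup>2 \<le> 8 / N\<^sup>2 * (D \<omega>)\<^sup>2 + 8 / (real n)\<^sup>2 * (L \<omega>)\<^sup>2"
      by (simp add: err power_mult_distrib power_divide)
  qed
  also have "\<dots> = 8 / N\<^sup>2 * expectation (\<lambda>\<omega>. (D \<omega>)\<^sup>2) + 8 / (real n)\<^sup>2 * expectation (\<lambda>\<omega>. (L \<omega>)\<^sup>2)"
    using sqD sqL by (simp add: square_integrable_def)
  also have "expectation (\<lambda>\<omega>. (D \<omega>)\<^sup>2) = N / 2 * (\<Sum>j<p. \<Sum>k<p. (?B j k)\<^sup>2)"
    unfolding D_def N_def by (rule V.expectation_pair_sum_sq) simp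
  also have L2: "expectation (\<lambda>\<omega>. (L \<omega>)\<^sup>2) = real n * quadratic_form p \<beta> ?B"
    unfolding L_def quadratic_form_def by (rule V.expectation_linear_form_sq)
  also have qB: "quadratic_form p \<beta> ?B = quadratic_form p \<beta> ?A - (signal_strength p \<beta>)\<^sup>2"
    unfolding quadratic_form_def signal_strength_sq
    by (simp add: sum_subtractf[symmetric] algebra_simps power2_eq_square)
  also have FB: "(\<Sum>j<p. \<Sum>k<p. (?B j k)\<^sup>2) = (frobenius_norm p ?A)\<^sup>2
      - 2 * quadratic_form p \<beta> ?A + (signal_strength p \<beta>)\<^sup>2"
    unfolding quadratic_form_def signal_strength_sq frobenius_norm_sq
    by (simp add: sum_subtractf[symmetric] sum.distrib[symmetric] sum_distrib_left algebra_simps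
        power2_eq_square)
  also have "8 / N\<^sup>2 * (N / 2 * x) + 8 / (real n)\<^sup>2 * (real n * y) = 4 / N * x + 8 / real n * y" for x y
    using N n by (simp add: power2_eq_square)
  finally have bound: "expectation (\<lambda>\<omega>. (err \<omega>)\<^sup>2) \<le> 4 / N * ((frobenius_norm p ?A)\<^sup>2
      - 2 * quadratic_form p \<beta> ?A + (signal_strength p \<beta>)\<^sup>2) +
      8 / real n * (quadratic_form p \<beta> ?A - (signal_strength p \<beta>)\<^sup>2)" .
  \<comment> \<open>The second moment of \<open>L\<close> is n (\<beta>^T A \<beta> - \<tau>^4), so
    its sign yields \<beta>^T A \<beta> \<ge> \<tau>^4. Hence -2 \<beta>^T A \<beta> + \<tau>^4
    \<le> 0, and the Frobenius norm of the covariance is at most that of A.\<close>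
  have "0 \<le> expectation (\<lambda>\<omega>. (L \<omega>)\<^sup>2)" by simp
  then have q: "(signal_strength p \<beta>)\<^sup>2 \<le> quadratic_form p \<beta> ?A"
    unfolding L2 qB using n by (simp add: zero_le_mult_iff)
  have "4 / N * ((frobenius_norm p ?A)\<^sup>2 - 2 * quadratic_form p \<beta> ?A + (signal_strength p \<beta>)\<^sup>2)
      \<le> 4 / N * (frobenius_norm p ?A)\<^sup>2"
    using N q by (intro mult_left_mono) (smt (verit) zero_le_power2, simp)
  moreover have "8 / real n * (quadratic_form p \<beta> ?A - (signal_strength p \<beta>)\<^sup>2)
      \<le> 8 / real n * quadratic_form p \<beta> ?A"
    by (intro mult_left_mono) auto
  ultimately show "expectation (\<lambda>\<omega>. (err \<omega>)\<^sup>2) \<le>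
         4 * (frobenius_norm p ?A)\<^sup>2 / (real n * (real n - 1)) + 8 * quadratic_form p \<beta> ?A / real n"
    using bound by (simp add: N_def)
qed

end

section \<open>Fourth-order mixed moments of independent standardized variables\<close>

locale independent_standardized = prob_space M
  for M :: "'a measure" +
  fixes p :: nat
    and U :: "nat \<Rightarrow> 'a \<Rightarrow> real"
  assumes indep: "indep_vars (\<lambda>_. borel) U {..<p}"
    and mean: "\<And>j. j < p \<Longrightarrow> expectation (U j) = 0"
    and variance: "\<And>j. j < p \<Longrightarrow> expectation (\<lambda>\<omega>. (U j \<omega>)\<^sup>2) = 1"
    and fourth_moment: "\<And>j. j < p \<Longrightarrow> integrable M (\<lambda>\<omega>. (U j \<omega>) ^ 4)"
begin

lemma U_measurable: "j < p \<Longrightarrow> U j \<in> borel_measurable M"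
  using indep by (auto simp: indep_vars_def)

lemma square_integrable_square_U: "j < p \<Longrightarrow> square_integrable M (\<lambda>\<omega>. (U j \<omega>)\<^sup>2)"
  using U_measurable fourth_moment by (simp add: square_integrable_def)

lemma square_integrable_U: "j < p \<Longrightarrow> square_integrable M (U j)"
  using U_measurable square_integrable_integrable[OF square_integrable_square_U]
  by (simp add: square_integrable_def)

lemma square_integrable_U_mult:
  assumes "j < p" "k < p"
  shows "square_integrable M (\<lambda>\<omega>. U j \<omega> * U k \<omega>)"
  using square_integrable_mult[OF square_integrable_square_U square_integrable_square_U, of j k]
    square_integrable_mult[OF square_integrable_U square_integrable_U, of j k] assms
  by (auto simp: square_integrable_def power_mult_distrib)

text \<open>The variable whose index occurs only once is independent of the other three and has mean
  zero. Those three may coincide.\<close>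

lemma expectation_isolated_index:
  assumes "j < p" "k < p" "l < p" "m < p" "m \<notin> {j, k, l}"
  shows "expectation (\<lambda>\<omega>. U j \<omega> * U k \<omega> * (U l \<omega> * U m \<omega>)) = 0"
proof -
  have meas: "(\<lambda>z. z j * z k * z l) \<in> borel_measurable (PiM {j, k, l} (\<lambda>_. borel :: real measure))"
    by (intro borel_measurable_times) auto
  have "indep_var borel (\<lambda>\<omega>. U j \<omega> * U k \<omega> * U l \<omega>) borel (U m)"
    using indep_vars_functions_of_disjoint[OF indep _ _ assms(5) meas measurable_ident] assms(1-4)
    by (simp add: id_def)
  then have "expectation (\<lambda>\<omega>. U j \<omega> * U k \<omega> * U l \<omega> * U m \<omega>) =
      expectation (\<lambda>\<omega>. U j \<omega> * U k \<omega> * U l \<omega>) * expectation (U m)"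
  proof (rule indep_var_lebesgue_integral)
    show "integrable M (\<lambda>\<omega>. U j \<omega> * U k \<omega> * U l \<omega>)"
      using assms(1-3) by (rule square_integrable_mult[OF square_integrable_U_mult square_integrable_U])
    show "integrable M (U m)"
      using assms(4) by (rule square_integrable_integrable[OF square_integrable_U])
  qed
  then show ?thesis
    using assms by (simp add: mean mult.assoc)
qed

lemma expectation_square_product:
  assumes "j < p" "k < p" "j \<noteq> k"
  shows "expectation (\<lambda>\<omega>. (U j \<omega>)\<^sup>2 * (U k \<omega>)\<^sup>2) = 1"
proof -
  have "(\<lambda>z. (z j)\<^sup>2) \<in> borel_measurable (PiM {j} (\<lambda>_. borel :: real measure))"
    by (intro borel_measurable_power) auto
  with assms have "indep_var borel (\<lambda>\<omega>. (U j \<omega>)\<^sup>2) borel (\<lambda>\<omega>. (U k \<omega>)\<^sup>2)"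
    using indep_vars_functions_of_disjoint[OF indep, of "{j}" k "\<lambda>z. (z j)\<^sup>2" "\<lambda>x. x\<^sup>2"]
    by simp
  from expectation_mult_indep[OF this] show ?thesis
    using assms by (simp add: square_integrable_square_U variance)
qed

text \<open>The Gaussian pairing formula with a kurtosis correction: when all four indices agree the
  three pairings count 3, and the last term replaces this by the fourth moment.\<close>

lemma expectation_four_product:
  assumes "j < p" "k < p" "l < p" "m < p"
  shows "expectation (\<lambda>\<omega>. U j \<omega> * U k \<omega> * (U l \<omega> * U m \<omega>)) =
    of_bool (j = k) * of_bool (l = m) + of_bool (l = j) * of_bool (m = k)
    + of_bool (m = j) * of_bool (l = k)
    + of_bool (j = k) * of_bool (l = j) * of_bool (m = j) * (expectation (\<lambda>\<omega>. (U j \<omega>) ^ 4) - 3)"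
proof -
  note iso = expectation_isolated_index
  \<comment> \<open>Either some index is isolated, or the indices form two distinct pairs in one of
    three ways, or all agree.\<close>
  consider (m) "m \<notin> {j, k, l}" | (l) "l \<notin> {j, k, m}" | (k) "k \<notin> {j, l, m}" | (j) "j \<notin> {k, l, m}"
    | (jk) "j = k" "l = m" "j \<noteq> l" | (jl) "j = l" "k = m" "j \<noteq> k" | (jm) "j = m" "k = l" "j \<noteq> k"
    | (all) "j = k" "l = j" "m = j"
    by auto
  then show ?thesis
  proof cases
    case m
    then show ?thesis using iso[OF assms] by auto
  next
    case l
    then show ?thesis using iso[of j k m l] assms by (auto simp: mult_ac)
  next
    case k
    then show ?thesis using iso[of j l m k] assms by (auto simp: mult_ac)
  next
    case j
    then show ?thesis using iso[of k l m j] assms by (auto simp: mult_ac)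
  next
    case jk
    then show ?thesis
      using expectation_square_product[of j l] assms by (simp add: power2_eq_square mult_ac)
  next
    case jl
    then show ?thesis
      using expectation_square_product[of j k] assms by (simp add: power2_eq_square mult_ac)
  next
    case jm
    then show ?thesis
      using expectation_square_product[of j k] assms by (simp add: power2_eq_square mult_ac)
  next
    case all
    then show ?thesis by (simp add: power4_eq_xxxx mult_ac)
  qed
qed

text \<open>Weight each pairing by b_l b_m. Pairing l with m leaves \<parallel>b\<parallel>^2 when j
  = k; the two crossed pairings give b_j b_k each; the correction survives only if all indices equal
  j.\<close>

lemma expectation_linear_form_weighted:
  assumes "j < p" "k < p"
  shows "expectation (\<lambda>\<omega>. (U j \<omega> * (\<Sum>l<p. b l * U l \<omega>)) * (U k \<omega> * (\<Sum>l<p. b l * U l \<omega>))) =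
     2 * b j * b k
     + of_bool (j = k) * (signal_strength p b + (b j)\<^sup>2 * (expectation (\<lambda>\<omega>. (U j \<omega>) ^ 4) - 3))"
proof -
  let ?c = "expectation (\<lambda>\<omega>. (U j \<omega>) ^ 4) - 3"
  have int: "integrable M (\<lambda>\<omega>. U j \<omega> * U k \<omega> * (U l \<omega> * U m \<omega>))" if "l < p" "m < p" for l m
    by (rule square_integrable_mult[OF square_integrable_U_mult[OF assms]
          square_integrable_U_mult[OF that]])
  have "expectation (\<lambda>\<omega>. (U j \<omega> * (\<Sum>l<p. b l * U l \<omega>)) * (U k \<omega> * (\<Sum>l<p. b l * U l \<omega>))) =
    expectation (\<lambda>\<omega>. \<Sum>l<p. \<Sum>m<p. b l * b m * (U j \<omega> * U k \<omega> * (U l \<omega> * U m \<omega>)))"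
    by (simp add: sum_distrib_left sum_distrib_right algebra_simps)
  also have "\<dots> = (\<Sum>l<p. \<Sum>m<p. b l * b m * (of_bool (j = k) * of_bool (l = m)
    + of_bool (l = j) * of_bool (m = k) + of_bool (m = j) * of_bool (l = k)
    + of_bool (j = k) * of_bool (l = j) * of_bool (m = j) * ?c))"
    using assms
    by (subst integral_double_sum) (simp_all add: int expectation_four_product)
  also have "\<dots> = (\<Sum>l<p. of_bool (j = k) * (b l)\<^sup>2 + of_bool (l = j) * b l * b k
    + of_bool (l = k) * b l * b j + of_bool (l = j) * (of_bool (j = k) * ?c * b l * b j))"
  proof (intro sum.cong refl)
    fix l assume l: "l \<in> {..<p}"
    \<comment> \<open>In each term the indicators fix m; written as conditionals on m they let the
      sum over m collapse. The sum over l is treated likewise afterwards.\<close>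
    have "(\<Sum>m<p. b l * b m * (of_bool (j = k) * of_bool (l = m)
        + of_bool (l = j) * of_bool (m = k) + of_bool (m = j) * of_bool (l = k)
        + of_bool (j = k) * of_bool (l = j) * of_bool (m = j) * ?c)) =
      (\<Sum>m<p. (if m = l then of_bool (j = k) * b l * b m else 0)
        + (if m = k then of_bool (l = j) * b l * b m else 0)
        + (if m = j then of_bool (l = k) * b l * b m else 0)
        + (if m = j then of_bool (l = j) * (of_bool (j = k) * ?c * b l * b m) else 0))"
    proof (intro sum.cong refl)
      fix m
      show "b l * b m * (of_bool (j = k) * of_bool (l = m)
        + of_bool (l = j) * of_bool (m = k) + of_bool (m = j) * of_bool (l = k)
        + of_bool (j = k) * of_bool (l = j) * of_bool (m = j) * ?c) =
        (if m = l then of_bool (j = k) * b l * b m else 0)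
        + (if m = k then of_bool (l = j) * b l * b m else 0)
        + (if m = j then of_bool (l = k) * b l * b m else 0)
        + (if m = j then of_bool (l = j) * (of_bool (j = k) * ?c * b l * b m) else 0)"
        by (cases "m = l"; cases "m = k"; cases "m = j"; cases "l = j"; cases "l = k")
          (simp_all add: algebra_simps)
    qed
    also have "\<dots> = of_bool (j = k) * (b l)\<^sup>2 + of_bool (l = j) * b l * b k
      + of_bool (l = k) * b l * b j + of_bool (l = j) * (of_bool (j = k) * ?c * b l * b j)"
      using assms l by (simp add: sum.distrib power2_eq_square)
    finally show "(\<Sum>m<p. b l * b m * (of_bool (j = k) * of_bool (l = m)
        + of_bool (l = j) * of_bool (m = k) + of_bool (m = j) * of_bool (l = k)
        + of_bool (j = k) * of_bool (l = j) * of_bool (m = j) * ?c)) =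
      of_bool (j = k) * (b l)\<^sup>2 + of_bool (l = j) * b l * b k
      + of_bool (l = k) * b l * b j + of_bool (l = j) * (of_bool (j = k) * ?c * b l * b j)" .
  qed
  also have "\<dots> = (\<Sum>l<p. of_bool (j = k) * (b l)\<^sup>2 + (if l = j then b l * b k else 0)
    + (if l = k then b l * b j else 0) + (if l = j then of_bool (j = k) * ?c * b l * b j else 0))"
    by (intro sum.cong refl) simp
  also have "\<dots> = 2 * b j * b k + of_bool (j = k) * (signal_strength p b + (b j)\<^sup>2 * ?c)"
    using assms
    by (cases "j = k") (simp_all add: sum.distrib signal_strength_def power2_eq_square algebra_simps)
  finally show ?thesis .
qed

end

section \<open>The matrix A for independent columns\<close>

context linear_model_sample
begin

text \<open>Split W into X_j (\<beta> \<bullet> X) + X_j \<epsilon>. Mixed products are linear in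
  the noise and vanish, the noise part contributes \<sigma>^2 on the diagonal, and the signal part
  is a fourth-order moment of independent coordinates.\<close>

lemma
  assumes n: "0 < n"
    and columns: "independent_columns M n p X"
    and fourth_moment: "\<And>j. j < p \<Longrightarrow> integrable M (\<lambda>\<omega>. (X 0 j \<omega>) ^ 4)"
  shows A_matrix_exists_independent_columns: "A_matrix_exists M p X Y"
    and A_matrix_independent_columns:
      "\<And>j k. j < p \<Longrightarrow> k < p \<Longrightarrow> A_matrix M X Y j k = 2 * \<beta> j * \<beta> k
        + of_bool (j = k) * (signal_strength p \<beta> + \<sigma>\<^sup>2
            + (\<beta> j)\<^sup>2 * (expectation (\<lambda>\<omega>. (X 0 j \<omega>) ^ 4) - 3))"
proof -
  interpret U: independent_standardized M p "X 0"
  proof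
    show "indep_vars (\<lambda>_. borel) (X 0) {..<p}"
      using columns n by (simp add: independent_columns_def)
    show "expectation (X 0 j) = 0" "expectation (\<lambda>\<omega>. (X 0 j \<omega>)\<^sup>2) = 1" if "j < p" for j
      using covariate_mean expectation_covariate_product[of 0 j j] n that
      by (simp_all add: power2_eq_square)
  qed (fact fourth_moment)
  have "square_integrable M (\<lambda>\<omega>. \<Sum>l<p. \<beta> l * (X 0 j \<omega> * X 0 l \<omega>))" if "j < p" for j
    using that by (intro square_integrable_sum square_integrable_cmult U.square_integrable_U_mult) auto
  then have sqXS: "square_integrable M (\<lambda>\<omega>. X 0 j \<omega> * signal 0 \<omega>)" if "j < p" for j
    using that by (simp add: signal_def sum_distrib_left mult.left_commute)
  \<comment> \<open>Conditioning on the covariates makes X_j^2 \<epsilon>^2 integrable using only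
    second moments of both factors.\<close>
  have sqXe: "square_integrable M (\<lambda>\<omega>. X 0 j \<omega> * \<epsilon> 0 \<omega>)" if "j < p" for j
    using integrable_mult_noise_sq[OF n, of "\<lambda>\<omega>. (X 0 j \<omega>)\<^sup>2"] n that
      X_measurable_covariate_algebra[OF n that] covariate_square_integrable[OF n that]
      square_integrable_X[OF n that] square_integrable_noise[OF n]
    by (auto simp: square_integrable_def power_mult_distrib)
  have W: "W X Y 0 j \<omega> = X 0 j \<omega> * signal 0 \<omega> + X 0 j \<omega> * \<epsilon> 0 \<omega>" if "\<omega> \<in> space M" for j \<omega>
    using n that by (simp add: W_def Y_eq distrib_left)
  have sq: "square_integrable M (\<lambda>\<omega>. X 0 j \<omega> * signal 0 \<omega> + X 0 j \<omega> * \<epsilon> 0 \<omega>)" if "j < p" for j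
    using that by (intro square_integrable_add sqXS sqXe)
  show "A_matrix_exists M p X Y"
    unfolding A_matrix_exists_def
    using square_integrable_mult[OF sq sq] W
    by (auto cong: Bochner_Integration.integrable_cong)
  fix j k assume j: "j < p" and k: "k < p"
  note ints = square_integrable_mult[OF sqXS[OF j] sqXS[OF k]]
    square_integrable_mult[OF sqXS[OF j] sqXe[OF k]]
    square_integrable_mult[OF sqXS[OF k] sqXe[OF j]]
    square_integrable_mult[OF sqXe[OF j] sqXe[OF k]]
  have cross: "expectation (\<lambda>\<omega>. (X 0 j \<omega> * signal 0 \<omega>) * (X 0 k \<omega> * \<epsilon> 0 \<omega>)) = 0"
    if "j < p" "k < p" for j k
  proof -
    have "(\<lambda>\<omega>. X 0 j \<omega> * signal 0 \<omega> * X 0 k \<omega>) \<in> borel_measurable (covariate_algebra 0)"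
      using n that
      by (intro borel_measurable_times X_measurable_covariate_algebra
          signal_measurable_covariate_algebra)
    from noise_orthogonal[OF n this] show ?thesis
      using square_integrable_mult[OF sqXS[OF that(1)] sqXe[OF that(2)]] by (simp add: mult.assoc)
  qed
  have "expectation (\<lambda>\<omega>. (X 0 j \<omega> * \<epsilon> 0 \<omega>) * (X 0 k \<omega> * \<epsilon> 0 \<omega>)) =
    expectation (\<lambda>\<omega>. (X 0 j \<omega> * X 0 k \<omega>) * (\<epsilon> 0 \<omega>)\<^sup>2)"
    by (simp add: power2_eq_square mult_ac)
  also have "\<dots> = \<sigma>\<^sup>2 * of_bool (j = k)"
    using n j k expectation_covariate_product[OF n j k]
    by (subst expectation_mult_noise_sq)
      (auto intro!: borel_measurable_times X_measurable_covariate_algebra square_integrable_mult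
        square_integrable_X)
  finally have noise: "expectation (\<lambda>\<omega>. (X 0 j \<omega> * \<epsilon> 0 \<omega>) * (X 0 k \<omega> * \<epsilon> 0 \<omega>)) =
      \<sigma>\<^sup>2 * of_bool (j = k)" .
  have "A_matrix M X Y j k = expectation (\<lambda>\<omega>.
      (X 0 j \<omega> * signal 0 \<omega>) * (X 0 k \<omega> * signal 0 \<omega>)
      + (X 0 j \<omega> * signal 0 \<omega>) * (X 0 k \<omega> * \<epsilon> 0 \<omega>)
      + (X 0 k \<omega> * signal 0 \<omega>) * (X 0 j \<omega> * \<epsilon> 0 \<omega>)
      + (X 0 j \<omega> * \<epsilon> 0 \<omega>) * (X 0 k \<omega> * \<epsilon> 0 \<omega>))"
    unfolding A_matrix_def
    by (rule Bochner_Integration.integral_cong) (simp_all add: W distrib_left distrib_right mult_ac)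
  also have "\<dots> = expectation (\<lambda>\<omega>. (X 0 j \<omega> * signal 0 \<omega>) * (X 0 k \<omega> * signal 0 \<omega>))
      + \<sigma>\<^sup>2 * of_bool (j = k)"
    using ints cross[OF j k] cross[OF k j] noise
    by (simp only: Bochner_Integration.integral_add Bochner_Integration.integrable_add)
  also have "\<dots> = 2 * \<beta> j * \<beta> k + of_bool (j = k) * (signal_strength p \<beta> + \<sigma>\<^sup>2
            + (\<beta> j)\<^sup>2 * (expectation (\<lambda>\<omega>. (X 0 j \<omega>) ^ 4) - 3))"
    unfolding signal_def U.expectation_linear_form_weighted[OF j k] by (simp add: algebra_simps)
  finally show "A_matrix M X Y j k = 2 * \<beta> j * \<beta> k + of_bool (j = k) * (signal_strength p \<beta> + \<sigma>\<^sup>2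
            + (\<beta> j)\<^sup>2 * (expectation (\<lambda>\<omega>. (X 0 j \<omega>) ^ 4) - 3))" .
qed

end

section \<open>Tail bound for the error and size of A for independent columns\<close>

context linear_model_sample
begin

text \<open>Markov's inequality for the squared error, with the mean squared error put over
  n^2.\<close>

lemma naive_error_tail:
  assumes A: "A_matrix_exists M p X Y" and n: "2 \<le> n" and a: "0 < a"
  shows "prob {\<omega> \<in> space M. \<bar>naive_estimator n p X Y \<omega> - signal_strength p \<beta>\<bar> > a} \<le>
    (8 * ((frobenius_norm p (A_matrix M X Y))\<^sup>2 / (real n)\<^sup>2)
      + 8 * quadratic_form p \<beta> (A_matrix M X Y) / real n) / a\<^sup>2"
proof -
  let ?err = "\<lambda>\<omega>. naive_estimator n p X Y \<omega> - signal_strength p \<beta>"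
  let ?F = "(frobenius_norm p (A_matrix M X Y))\<^sup>2"
  have meas: "?err \<in> borel_measurable M" and int: "integrable M (\<lambda>\<omega>. (?err \<omega>)\<^sup>2)"
    using square_integrable_naive_error[OF A n] by (simp_all add: square_integrable_def)
  have "prob {\<omega> \<in> space M. \<bar>?err \<omega>\<bar> > a} \<le> prob {\<omega> \<in> space M. \<bar>?err \<omega>\<bar> \<ge> a}"
    using meas by (intro finite_measure_mono) auto
  also have "\<dots> \<le> expectation (\<lambda>\<omega>. (?err \<omega>)\<^sup>2) / a\<^sup>2"
    by (rule second_moment_method[OF meas int a])
  also have "\<dots> \<le> (8 * (?F / (real n)\<^sup>2) + 8 * quadratic_form p \<beta> (A_matrix M X Y) / real n) / a\<^sup>2"
  proof (rule divide_right_mono)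
    \<comment> \<open>For n \<ge> 2 we have n - 1 \<ge> n / 2, which turns 4 / (n (n - 1)) into 8 /
      n^2.\<close>
    have "(real n)\<^sup>2 / 2 \<le> real n * (real n - 1)"
      using n mult_left_mono[of "real n / 2" "real n - 1" "real n"] by (simp add: power2_eq_square)
    then have "4 * ?F / (real n * (real n - 1)) \<le> 4 * ?F / ((real n)\<^sup>2 / 2)"
      using n by (intro divide_left_mono) auto
    then show "expectation (\<lambda>\<omega>. (?err \<omega>)\<^sup>2) \<le>
        8 * (?F / (real n)\<^sup>2) + 8 * quadratic_form p \<beta> (A_matrix M X Y) / real n"
      using expectation_naive_error_sq[OF A n] by simp
  qed simp
  finally show ?thesis .
qed

text \<open>A is 2 \<beta> \<beta>^T plus a diagonal with entries \<open>d j\<close> bounded by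
  \<open>K * (C + 4)\<close>. The rank-one part has bounded norm, and only the \<open>p\<close>
  diagonal entries make the squared norm grow.\<close>

lemma
  fixes C K :: real
  assumes n: "0 < n"
    and columns: "independent_columns M n p X"
    and fourth_moment: "\<And>j. j < p \<Longrightarrow> integrable M (\<lambda>\<omega>. (X 0 j \<omega>) ^ 4)"
    and fourth_moment_le: "\<And>j. j < p \<Longrightarrow> expectation (\<lambda>\<omega>. (X 0 j \<omega>) ^ 4) \<le> C"
    and C: "0 \<le> C" and K: "signal_strength p \<beta> + \<sigma>\<^sup>2 \<le> K"
  shows frobenius_norm_sq_le_independent_columns:
      "(frobenius_norm p (A_matrix M X Y))\<^sup>2 \<le> 8 * K\<^sup>2 + 2 * real p * (K * (C + 4))\<^sup>2"
    and quadratic_form_le_independent_columns: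
      "quadratic_form p \<beta> (A_matrix M X Y) \<le> 2 * K\<^sup>2 + K * (K * (C + 4))"
proof -
  define d where "d j = signal_strength p \<beta> + \<sigma>\<^sup>2
            + (\<beta> j)\<^sup>2 * (expectation (\<lambda>\<omega>. (X 0 j \<omega>) ^ 4) - 3)" for j
  have A: "A_matrix M X Y j k = 2 * \<beta> j * \<beta> k + of_bool (j = k) * d j" if "j < p" "k < p" for j k
    using A_matrix_independent_columns[OF n columns fourth_moment that] by (simp add: d_def)
  have s: "0 \<le> signal_strength p \<beta>" "signal_strength p \<beta> \<le> K"
    using K signal_strength_nonneg[of p \<beta>] zero_le_power2[of \<sigma>] by linarith+
  have s2: "(signal_strength p \<beta>)\<^sup>2 \<le> K\<^sup>2"
    using s by (intro power_mono)
  \<comment> \<open>The fourth moment lies between 0 and \<open>C\<close>, so it differs from 3 by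
    at most \<open>C + 3\<close>; with \<beta>_j^2 \<le> K this gives \<open>K * (C + 3)\<close>,
    and \<tau>^2 + \<sigma>^2 adds another \<open>K\<close>.\<close>
  have d: "\<bar>d j\<bar> \<le> K * (C + 4)" if j: "j < p" for j
  proof -
    let ?m = "expectation (\<lambda>\<omega>. (X 0 j \<omega>) ^ 4)"
    have "0 \<le> ?m" by simp
    then have m: "\<bar>?m - 3\<bar> \<le> C + 3"
      using fourth_moment_le[OF j] by linarith
    have "(\<beta> j)\<^sup>2 \<le> signal_strength p \<beta>"
      unfolding signal_strength_def using j by (intro member_le_sum) auto
    then have "\<bar>(\<beta> j)\<^sup>2 * (?m - 3)\<bar> \<le> K * (C + 3)"
      unfolding abs_mult using m s by (intro mult_mono) auto
    moreover have "\<bar>signal_strength p \<beta> + \<sigma>\<^sup>2\<bar> \<le> K"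
      using K s by simp
    ultimately show ?thesis
      unfolding d_def by (simp add: algebra_simps)
  qed
  have "(A_matrix M X Y j k)\<^sup>2 \<le> 8 * (\<beta> j * \<beta> k)\<^sup>2 + (if k = j then 2 * (K * (C + 4))\<^sup>2 else 0)"
    if "j < p" "k < p" for j k
  proof -
    have "(d j)\<^sup>2 \<le> (K * (C + 4))\<^sup>2"
      using d[OF that(1)] by (metis abs_ge_zero power2_abs power_mono)
    moreover have "(2 * (\<beta> j * \<beta> k) + d j)\<^sup>2 \<le> 8 * (\<beta> j * \<beta> k)\<^sup>2 + 2 * (d j)\<^sup>2"
      using sum_squares_bound[of "2 * (\<beta> j * \<beta> k)" "d j"] by (simp add: power2_sum power_mult_distrib)
    ultimately show ?thesis
      unfolding A[OF that] by (auto simp: mult.assoc power_mult_distrib)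
  qed
  then have "(frobenius_norm p (A_matrix M X Y))\<^sup>2 \<le>
      (\<Sum>j<p. \<Sum>k<p. 8 * (\<beta> j * \<beta> k)\<^sup>2 + (if k = j then 2 * (K * (C + 4))\<^sup>2 else 0))"
    unfolding frobenius_norm_sq by (intro sum_mono) auto
  also have "\<dots> = 8 * (signal_strength p \<beta>)\<^sup>2 + 2 * real p * (K * (C + 4))\<^sup>2"
    unfolding signal_strength_sq by (simp add: sum.distrib sum_distrib_left)
  finally show "(frobenius_norm p (A_matrix M X Y))\<^sup>2 \<le> 8 * K\<^sup>2 + 2 * real p * (K * (C + 4))\<^sup>2"
    using s2 by linarith
  have "quadratic_form p \<beta> (A_matrix M X Y) =
      (\<Sum>j<p. \<Sum>k<p. 2 * (\<beta> j * \<beta> k)\<^sup>2 + (if k = j then (\<beta> j)\<^sup>2 * d j else 0))"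
    unfolding quadratic_form_def
    by (intro sum.cong refl) (auto simp: A power2_eq_square algebra_simps)
  also have "\<dots> = 2 * (signal_strength p \<beta>)\<^sup>2 + (\<Sum>j<p. (\<beta> j)\<^sup>2 * d j)"
    unfolding signal_strength_sq by (simp add: sum.distrib sum_distrib_left)
  also have "(\<Sum>j<p. (\<beta> j)\<^sup>2 * d j) \<le> (\<Sum>j<p. (\<beta> j)\<^sup>2 * (K * (C + 4)))"
    using d by (intro sum_mono mult_left_mono) (auto simp: abs_le_iff)
  also have "\<dots> = signal_strength p \<beta> * (K * (C + 4))"
    by (simp add: signal_strength_def sum_distrib_right)
  also have "\<dots> \<le> K * (K * (C + 4))"
    using s C by (intro mult_right_mono) auto
  finally show "quadratic_form p \<beta> (A_matrix M X Y) \<le> 2 * K\<^sup>2 + K * (K * (C + 4))"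
    using s2 by linarith
qed

end

section \<open>Consistency and the root-n rate\<close>

theorem proposition2:
  fixes M :: "nat \<Rightarrow> 'a measure"
    and p :: "nat \<Rightarrow> nat"
    and \<beta> :: "nat \<Rightarrow> nat \<Rightarrow> real"
    and \<sigma> :: "nat \<Rightarrow> real"
    and X :: "nat \<Rightarrow> nat \<Rightarrow> nat \<Rightarrow> 'a \<Rightarrow> real"
    and \<epsilon> Y :: "nat \<Rightarrow> nat \<Rightarrow> 'a \<Rightarrow> real"
  assumes model:
      "\<And>n. n \<ge> 1 \<Longrightarrow> linear_model_sample (M n) n (p n) (\<beta> n) (\<sigma> n) (X n) (\<epsilon> n) (Y n)"
    and p_to_infinity: "filterlim p at_top sequentially"
    and bounded_signal_noise: "(\<lambda>n. signal_strength (p n) (\<beta> n) + (\<sigma> n)\<^sup>2) \<in> O(\<lambda>_. 1)"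
  shows
    "((\<forall>n\<ge>1. A_matrix_exists (M n) (p n) (X n) (Y n)) \<longrightarrow>
      (\<lambda>n. (frobenius_norm (p n) (A_matrix (M n) (X n) (Y n)))\<^sup>2 / (real n)\<^sup>2) \<longlonglongrightarrow> 0 \<longrightarrow>
      tends_to_zero_in_probability M
        (\<lambda>n \<omega>. naive_estimator n (p n) (X n) (Y n) \<omega> - signal_strength (p n) (\<beta> n)))
     \<and>
     ((\<forall>n\<ge>1. independent_columns (M n) n (p n) (X n)) \<longrightarrow>
      (\<lambda>n. real (p n) / real n) \<in> O(\<lambda>_. 1) \<longrightarrow>
      (\<exists>C. \<forall>n\<ge>1. \<forall>i<n. \<forall>j<p n.
         integrable (M n) (\<lambda>\<omega>. (X n i j \<omega>) ^ 4) \<and> (LINT \<omega>|M n. (X n i j \<omega>) ^ 4) \<le> C) \<longrightarrow>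
      (\<forall>n\<ge>1. A_matrix_exists (M n) (p n) (X n) (Y n)) \<and>
      (\<lambda>n. (frobenius_norm (p n) (A_matrix (M n) (X n) (Y n)))\<^sup>2 / (real n)\<^sup>2) \<longlonglongrightarrow> 0 \<and>
      bounded_in_probability M
        (\<lambda>n \<omega>. sqrt (real n) *
           (naive_estimator n (p n) (X n) (Y n) \<omega> - signal_strength (p n) (\<beta> n))))"
proof -
  define F where "F n = frobenius_norm (p n) (A_matrix (M n) (X n) (Y n))" for n
  define q where "q n = quadratic_form (p n) (\<beta> n) (A_matrix (M n) (X n) (Y n))" for n
  define s where "s n = signal_strength (p n) (\<beta> n)" for n
  define err where "err n \<omega> = naive_estimator n (p n) (X n) (Y n) \<omega> - s n" for n \<omega>
  have F0: "0 \<le> F n" for n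
    by (simp add: F_def frobenius_norm_def sum_nonneg)
  have s0: "0 \<le> s n" for n
    by (simp add: s_def signal_strength_nonneg)
  \<comment> \<open>The O-bound holds only for large n, so the estimates built on it are
    eventual.\<close>
  obtain K where "\<forall>\<^sub>F n in sequentially. norm (s n + (\<sigma> n)\<^sup>2) \<le> K * norm (1::real)"
    using bounded_signal_noise unfolding s_def by (elim landau_o.bigE)
  then have K: "\<forall>\<^sub>F n in sequentially. s n + (\<sigma> n)\<^sup>2 \<le> K"
    by (rule eventually_mono) simp
  have tail: "measure (M n) {\<omega> \<in> space (M n). \<bar>err n \<omega>\<bar> > a} \<le>
      (8 * ((F n)\<^sup>2 / (real n)\<^sup>2) + 8 * q n / real n) / a\<^sup>2"
    if "A_matrix_exists (M n) (p n) (X n) (Y n)" "2 \<le> n" "0 < a" for n a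
    using linear_model_sample.naive_error_tail[OF model that] that(2)
    by (simp add: err_def F_def q_def s_def)
  have consistent: "tends_to_zero_in_probability M err"
    if ex: "\<forall>n\<ge>1. A_matrix_exists (M n) (p n) (X n) (Y n)"
      and lim: "(\<lambda>n. (F n)\<^sup>2 / (real n)\<^sup>2) \<longlonglongrightarrow> 0"
    unfolding tends_to_zero_in_probability_def
  proof (intro allI impI)
    fix \<delta> :: real assume \<delta>: "0 < \<delta>"
    let ?r = "\<lambda>n. (F n)\<^sup>2 / (real n)\<^sup>2"
    \<comment> \<open>Since \<beta>^T A \<beta> / n \<le> \<tau>^2 \<parallel>A\<parallel> / n \<le>
      K \<parallel>A\<parallel> / n, the linear part too is controlled by \<open>?r\<close>, through
      its square root.\<close>
    let ?b = "\<lambda>n. (8 * ?r n + 8 * K * sqrt (?r n)) / \<delta>\<^sup>2"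
    have upper: "\<forall>\<^sub>F n in sequentially. measure (M n) {\<omega> \<in> space (M n). \<bar>err n \<omega>\<bar> > \<delta>} \<le> ?b n"
      using K eventually_ge_at_top[of 2]
    proof eventually_elim
      case (elim n)
      have "q n \<le> s n * F n"
        unfolding q_def s_def F_def by (rule quadratic_form_le)
      also have "\<dots> \<le> K * F n"
        using elim(1) zero_le_power2[of "\<sigma> n"] by (intro mult_right_mono F0) linarith
      finally have "q n / real n \<le> K * F n / real n"
        by (rule divide_right_mono) simp
      also have "\<dots> = K * sqrt (?r n)"
        using F0[of n] by (simp add: real_sqrt_divide)
      finally have "(8 * ?r n + 8 * q n / real n) / \<delta>\<^sup>2 \<le> ?b n"
        by (intro divide_right_mono) auto
      with tail[of n \<delta>] show ?case
        using ex elim(2) \<delta> by force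
    qed
    have "?b \<longlonglongrightarrow> (8 * 0 + 8 * K * sqrt 0) / \<delta>\<^sup>2"
      using \<delta> by (intro tendsto_intros lim) auto
    then have lim_b: "?b \<longlonglongrightarrow> 0" by simp
    show "(\<lambda>n. measure (M n) {\<omega> \<in> space (M n). \<bar>err n \<omega>\<bar> > \<delta>}) \<longlonglongrightarrow> 0"
      by (rule tendsto_sandwich[OF _ upper tendsto_const lim_b]) simp
  qed
  have rate: "(\<forall>n\<ge>1. A_matrix_exists (M n) (p n) (X n) (Y n)) \<and>
      (\<lambda>n. (F n)\<^sup>2 / (real n)\<^sup>2) \<longlonglongrightarrow> 0 \<and>
      bounded_in_probability M (\<lambda>n \<omega>. sqrt (real n) * err n \<omega>)"
    if columns: "\<forall>n\<ge>1. independent_columns (M n) n (p n) (X n)"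
      and p_n: "(\<lambda>n. real (p n) / real n) \<in> O(\<lambda>_. 1)"
      and moments: "\<exists>C. \<forall>n\<ge>1. \<forall>i<n. \<forall>j<p n.
         integrable (M n) (\<lambda>\<omega>. (X n i j \<omega>) ^ 4) \<and> (LINT \<omega>|M n. (X n i j \<omega>) ^ 4) \<le> C"
  proof -
    obtain C' where "\<forall>n\<ge>1. \<forall>i<n. \<forall>j<p n.
         integrable (M n) (\<lambda>\<omega>. (X n i j \<omega>) ^ 4) \<and> (LINT \<omega>|M n. (X n i j \<omega>) ^ 4) \<le> C'"
      using moments by (elim exE)
    then have C': "\<And>n j. 1 \<le> n \<Longrightarrow> j < p n \<Longrightarrow> integrable (M n) (\<lambda>\<omega>. (X n 0 j \<omega>) ^ 4)"
      "\<And>n j. 1 \<le> n \<Longrightarrow> j < p n \<Longrightarrow> (LINT \<omega>|M n. (X n 0 j \<omega>) ^ 4) \<le> C'"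
      by (metis less_le_trans zero_less_one)+
    \<comment> \<open>The bounds for independent columns ask for a nonnegative moment bound; the
      maximum supplies one.\<close>
    define C where "C = max C' 0"
    have C: "0 \<le> C" "\<And>n j. 1 \<le> n \<Longrightarrow> j < p n \<Longrightarrow> (LINT \<omega>|M n. (X n 0 j \<omega>) ^ 4) \<le> C"
      using C'(2) by (auto simp: C_def intro: max.coboundedI1)
    obtain c where "\<forall>\<^sub>F n in sequentially. norm (real (p n) / real n) \<le> c * norm (1::real)"
      using p_n by (elim landau_o.bigE)
    then have c: "\<forall>\<^sub>F n in sequentially. real (p n) / real n \<le> c"
      by (rule eventually_mono) simp
    have ex: "A_matrix_exists (M n) (p n) (X n) (Y n)" if "1 \<le> n" for n
      using linear_model_sample.A_matrix_exists_independent_columns[OF model] columns C'(1) that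
      by simp
    \<comment> \<open>\<open>a\<close> bounds \<parallel>A\<parallel>^2 / n, using p / n \<le> c for
      the diagonal and 1 / n \<le> 1 for the rank-one part; \<open>b\<close> bounds \<beta>^T A
      \<beta>.\<close>
    define a where "a = 8 * K\<^sup>2 + 2 * c * (K * (C + 4))\<^sup>2"
    define b where "b = 2 * K\<^sup>2 + K * (K * (C + 4))"
    have bounds: "\<forall>\<^sub>F n in sequentially. (F n)\<^sup>2 / real n \<le> a \<and> q n \<le> b"
      using K c eventually_ge_at_top[of 1]
    proof eventually_elim
      case (elim n)
      have n: "0 < n" using elim(3) by simp
      have "(F n)\<^sup>2 \<le> 8 * K\<^sup>2 + 2 * real (p n) * (K * (C + 4))\<^sup>2"
        unfolding F_def
        using linear_model_sample.frobenius_norm_sq_le_independent_columns[OF model[OF elim(3)] n]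
          columns C'(1) C elim(1,3) by (simp add: s_def)
      then have "(F n)\<^sup>2 / real n \<le> (8 * K\<^sup>2 + 2 * real (p n) * (K * (C + 4))\<^sup>2) / real n"
        by (rule divide_right_mono) simp
      also have "\<dots> = 8 * K\<^sup>2 / real n + 2 * (real (p n) / real n) * (K * (C + 4))\<^sup>2"
        by (simp add: add_divide_distrib)
      also have "\<dots> \<le> a"
        unfolding a_def
      proof (intro add_mono mult_right_mono mult_left_mono elim(2))
        show "8 * K\<^sup>2 / real n \<le> 8 * K\<^sup>2"
          using n by (simp add: divide_le_eq mult_le_cancel_left1)
      qed auto
      moreover have "q n \<le> b"
        unfolding q_def b_def
        using linear_model_sample.quadratic_form_le_independent_columns[OF model[OF elim(3)] n]
          columns C'(1) C elim(1,3) by (simp add: s_def)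
      ultimately show ?case by simp
    qed
    have "(\<lambda>n. (F n)\<^sup>2 / (real n)\<^sup>2) \<longlonglongrightarrow> 0"
    proof (rule tendsto_sandwich[OF _ _ tendsto_const lim_const_over_n])
      show "\<forall>\<^sub>F n in sequentially. (F n)\<^sup>2 / (real n)\<^sup>2 \<le> a / real n"
        using bounds
      proof eventually_elim
        case (elim n)
        then have "(F n)\<^sup>2 / real n / real n \<le> a / real n"
          by (intro divide_right_mono) auto
        then show ?case by (simp add: power2_eq_square)
      qed
    qed simp
    moreover have "bounded_in_probability M (\<lambda>n \<omega>. sqrt (real n) * err n \<omega>)"
      unfolding bounded_in_probability_def
    proof (intro allI impI)
      fix \<delta> :: real assume \<delta>: "0 < \<delta>"
      \<comment> \<open>At the threshold \<open>R / sqrt (real n)\<close> the tail bound is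
        multiplied by n and becomes at most (8 a + 8 b) / R^2. \<open>R\<close> is chosen so that G
        / R^2 = \<delta>; absolute values and the summand 1 make \<open>G\<close> positive whatever
        the signs of \<open>a\<close> and \<open>b\<close>.\<close>
      define G where "G = 8 * \<bar>a\<bar> + 8 * \<bar>b\<bar> + 1"
      define R where "R = sqrt (G / \<delta>)"
      have G: "0 < G" by (simp add: G_def add_nonneg_pos)
      then have R: "0 < R" "R\<^sup>2 = G / \<delta>"
        using \<delta> by (simp_all add: R_def)
      have "\<forall>\<^sub>F n in sequentially.
          measure (M n) {\<omega> \<in> space (M n). \<bar>sqrt (real n) * err n \<omega>\<bar> > R} \<le> \<delta>"
        using bounds eventually_ge_at_top[of 2]
      proof eventually_elim
        case (elim n)
        then have n: "0 < real n" by simp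
        have "\<bar>sqrt (real n) * e\<bar> > R \<longleftrightarrow> \<bar>e\<bar> > R / sqrt (real n)" for e
          using n by (simp add: abs_mult divide_less_eq mult.commute)
        then have "measure (M n) {\<omega> \<in> space (M n). \<bar>sqrt (real n) * err n \<omega>\<bar> > R} \<le>
            (8 * ((F n)\<^sup>2 / (real n)\<^sup>2) + 8 * q n / real n) / (R / sqrt (real n))\<^sup>2"
          using tail[of n "R / sqrt (real n)"] ex[of n] elim(2) R n by simp
        also have "\<dots> = (8 * ((F n)\<^sup>2 / real n) + 8 * q n) / R\<^sup>2"
          using n R(1) by (simp add: power_divide field_simps power2_eq_square)
        also have "\<dots> \<le> G / R\<^sup>2"
          using elim(1) by (intro divide_right_mono) (auto simp: G_def)
        also have "\<dots> = \<delta>"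
          using G \<delta> R by simp
        finally show ?case .
      qed
      then show "\<exists>R. \<forall>\<^sub>F n in sequentially.
          measure (M n) {\<omega> \<in> space (M n). \<bar>sqrt (real n) * err n \<omega>\<bar> > R} \<le> \<delta>" ..
    qed
    ultimately show ?thesis using ex by blast
  qed
  show ?thesis
    using consistent rate unfolding err_def F_def s_def by blast
qed

end
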